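(* Let $K$ be a field and let $\mathcal L=\{L_1,\dots,L_s\}$, $s\ge3$, be a set of skew lines in $\mathbb P^3_K$. Then $G_{\mathcal L}$ is abelian if and only if $\mathcal L$ has either 2 or more distinct transversals or it has a transversal of multiplicity 2 (transversals being taken over the algebraic closure $\overline K$).
   Context: Let $\mathcal L=\{L_1,\dots,L_s\}$ be $s\ge3$ distinct pairwise disjoint (skew) lines in $\mathbb P^3_K$. For distinct $i,j,k$ let $f_{ijk}\colon L_i\to L_j$ be the linear isomorphism sending $p\in L_i$ to the point where the plane spanned by $p$ and $L_k$ meets $L_j$. The groupoid $C_{\mathcal L}$ has the lines $L_i$ as objects and all possible compositions of the maps $f_{ijk}$ as arrows. The groups $G_i=\mathrm{Hom}_{C_{\mathcal L}}(L_i,L_i)\subseteq\mathrm{Aut}(L_i)\cong PGL_2(K)$ are all isomorphic, and $G_{\mathcal L}$ denotes any of them; it is unchanged by extending the field. A transversal for $\mathcal L$ is a line meeting every line of $\mathcal L$. Three skew lines $L_{i},L_{j},L_{k}$ lie on a unique smooth quadric $Q_{ijk}$. For $s\geq 4$, a line $T$ is a transversal of multiplicity 2 for $\mathcal L$ if $T$ is a transversal for $\mathcal L$, no single smooth quadric contains all of the lines of $\mathcal L$, and for some three distinct indices $i_1,i_2,i_3$ each line $L_i\in\mathcal L$ is either contained in $Q_{i_1i_2i_3}$ or tangent to $Q_{i_1i_2i_3}$ at the point $L_i\cap T$. (This condition does not depend on the choice of the three indices.) *)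

theory Defs
  imports
    "HOL-Analysis.Analysis"
    "HOL-Algebra.Bij"
    "HOL-Algebra.Algebraic_Closure_Type"
begin

section \<open>Skew lines in projective 3-space\<close>

text \<open>Linear subvarieties of $\mathbb P^3_K$ are represented by the corresponding vector subspaces
  of $K^4$; projective dimension $d$ is vector space dimension $d+1$.\<close>

definition proj_point :: "('a::field ^ 4) set \<Rightarrow> bool" where
  "proj_point P \<longleftrightarrow> vec.subspace P \<and> vec.dim P = 1"

definition proj_line :: "('a::field ^ 4) set \<Rightarrow> bool" where
  "proj_line L \<longleftrightarrow> vec.subspace L \<and> vec.dim L = 2"

definition points :: "('a::field ^ 4) set \<Rightarrow> ('a ^ 4) set set" where
  "points L = {P. proj_point P \<and> P \<subseteq> L}"

definition skew :: "('a::field ^ 4) set \<Rightarrow> ('a ^ 4) set \<Rightarrow> bool" where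
  "skew L M \<longleftrightarrow> L \<inter> M = {0}"

definition skew_lines :: "('a::field ^ 4) set set \<Rightarrow> bool" where
  "skew_lines LL \<longleftrightarrow> (\<forall>L\<in>LL. proj_line L) \<and> pairwise skew LL"


section \<open>The groupoid of a set of skew lines\<close>

text \<open>For pairwise skew lines \<open>L\<close>, \<open>M\<close>, \<open>N\<close>, \<open>line_proj L M N\<close> is the map \<open>L \<rightarrow> M\<close> given by
  projection from \<open>N\<close>: here \<open>vec.span (P \<union> N)\<close> is the plane spanned by \<open>P\<close> and \<open>N\<close>.
  Morphisms of lines are represented by their action on \<open>K\<close>-rational points, made extensional so
  that equality of arrows is equality of functions. Nothing is lost, even over finite fields, as
  $\mathrm{PGL}_2(K)$ acts faithfully on $\mathbb P^1(K)$.\<close>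

definition line_proj ::
    "('a::field ^ 4) set \<Rightarrow> ('a ^ 4) set \<Rightarrow> ('a ^ 4) set \<Rightarrow> ('a ^ 4) set \<Rightarrow> ('a ^ 4) set" where
  "line_proj L M N = (\<lambda>P\<in>points L. vec.span (P \<union> N) \<inter> M)"

inductive arrow ::
    "('a::field ^ 4) set set \<Rightarrow> ('a ^ 4) set \<Rightarrow> ('a ^ 4) set \<Rightarrow> (('a ^ 4) set \<Rightarrow> ('a ^ 4) set) \<Rightarrow> bool"
  for LL where
  ident: "L \<in> LL \<Longrightarrow> arrow LL L L (\<lambda>P\<in>points L. P)"
| proj: "\<lbrakk>L \<in> LL; M \<in> LL; N \<in> LL; L \<noteq> M; L \<noteq> N; M \<noteq> N\<rbrakk> \<Longrightarrow> arrow LL L M (line_proj L M N)"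
| comp: "\<lbrakk>arrow LL L M f; arrow LL M N g\<rbrakk> \<Longrightarrow> arrow LL L N (compose (points L) g f)"

definition line_group :: "('a::field ^ 4) set set \<Rightarrow> ('a ^ 4) set \<Rightarrow> (('a ^ 4) set \<Rightarrow> ('a ^ 4) set) monoid" where
  "line_group LL L = BijGroup (points L)\<lparr>carrier := {f. arrow LL L L f}\<rparr>"


section \<open>Quadrics\<close>

text \<open>Quadrics are only considered over algebraically closed fields, where smoothness and
  containment can be tested on rational points. A quadratic form is given by an arbitrary matrix
  (not assumed symmetric, so that every form is obtained also in characteristic 2).\<close>

definition quad_form :: "'a::alg_closed_field ^ 4 ^ 4 \<Rightarrow> 'a ^ 4 \<Rightarrow> 'a" where
  "quad_form A x = (\<Sum>i\<in>UNIV. \<Sum>j\<in>UNIV. A $ i $ j * x $ i * x $ j)"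

text \<open>The vector of the four formal partial derivatives of \<open>quad_form A\<close> at \<open>x\<close>.\<close>

definition quad_grad :: "'a::alg_closed_field ^ 4 ^ 4 \<Rightarrow> 'a ^ 4 \<Rightarrow> 'a ^ 4" where
  "quad_grad A x = (A + transpose A) *v x"

text \<open>Jacobian criterion. The point must be required to lie on the quadric, since in
  characteristic 2 this does not follow from the vanishing of the derivatives.\<close>

definition smooth_quadric :: "'a::alg_closed_field ^ 4 ^ 4 \<Rightarrow> bool" where
  "smooth_quadric A \<longleftrightarrow> (\<forall>x. x \<noteq> 0 \<and> quad_form A x = 0 \<longrightarrow> quad_grad A x \<noteq> 0)"

definition in_quadric :: "('a::alg_closed_field ^ 4) set \<Rightarrow> 'a ^ 4 ^ 4 \<Rightarrow> bool" where
  "in_quadric L A \<longleftrightarrow> (\<forall>x\<in>L. quad_form A x = 0)"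

text \<open>The line \<open>L\<close> is tangent to the quadric at its point \<open>P\<close>: the quadric passes through \<open>P\<close>, and
  \<open>L\<close> lies in the tangent plane there.\<close>

definition tangent_at ::
    "('a::alg_closed_field ^ 4) set \<Rightarrow> 'a ^ 4 ^ 4 \<Rightarrow> ('a ^ 4) set \<Rightarrow> bool" where
  "tangent_at L A P \<longleftrightarrow>
     P \<in> points L \<and> (\<forall>x\<in>P. quad_form A x = 0 \<and> (\<forall>v\<in>L. (\<Sum>i\<in>UNIV. quad_grad A x $ i * v $ i) = 0))"


section \<open>Transversals\<close>

definition transversal :: "('a::field ^ 4) set set \<Rightarrow> ('a ^ 4) set \<Rightarrow> bool" where
  "transversal LL T \<longleftrightarrow> proj_line T \<and> (\<forall>L\<in>LL. L \<inter> T \<noteq> {0})"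

text \<open>Three skew lines lie on exactly one smooth quadric, so the matrix \<open>A\<close> below describes the
  quadric $Q_{i_1i_2i_3}$ through \<open>L1\<close>, \<open>L2\<close>, \<open>L3\<close>.\<close>

definition double_transversal :: "('a::alg_closed_field ^ 4) set set \<Rightarrow> ('a ^ 4) set \<Rightarrow> bool" where
  "double_transversal LL T \<longleftrightarrow>
     card LL \<ge> 4 \<and>
     transversal LL T \<and>
     \<not> (\<exists>A. smooth_quadric A \<and> (\<forall>L\<in>LL. in_quadric L A)) \<and>
     (\<exists>L1\<in>LL. \<exists>L2\<in>LL. \<exists>L3\<in>LL. L1 \<noteq> L2 \<and> L1 \<noteq> L3 \<and> L2 \<noteq> L3 \<and>
        (\<exists>A. smooth_quadric A \<and> in_quadric L1 A \<and> in_quadric L2 A \<and> in_quadric L3 A \<and>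
             (\<forall>L\<in>LL. in_quadric L A \<or> tangent_at L A (L \<inter> T))))"


section \<open>Extension of scalars to the algebraic closure\<close>

definition base_change :: "('a::field ^ 4) set \<Rightarrow> ('a alg_closure ^ 4) set" where
  "base_change L = vec.span ((\<lambda>x. \<chi> i. to_ac (x $ i)) ` L)"

end

(*
  Choose coordinates K^4 = K^2 + K^2 in which three of the lines are y = 0, x = 0 and y = x; every
  other line is then the graph y = A x of an invertible matrix A.  Identifying each line with K^2, the
  projections are given by the matrices A, A - B and their inverses, so G is generated in PGL_2(K) by
  the classes of the A and the A - B.  If G is abelian, then A and B commute up to a scalar, and so do
  1 - A and B; comparing the two relations shows that A and B commute as matrices.  Hence G is abelian
  if and only if the matrices A commute pairwise.

  Over the algebraic closure the transversals correspond to the common eigenlines of the matrices A.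
  Commuting matrices either have two common eigenlines, or are all of the form a + b N with N nilpotent
  and not all scalar.  The smooth quadric through the first three lines is "x and y are proportional",
  and tangency to it along the transversal through the eigenline spanned by u says that A - a maps K^2
  into that eigenline, where A u = a u; so the second case is that of a transversal of multiplicity 2.
*)

theory Submission
  imports Defs
begin

section \<open>Linear algebra\<close>

lemma proj_point_iff: "proj_point P \<longleftrightarrow> (\<exists>v. v \<noteq> 0 \<and> P = vec.span {v})"
proof
  assume P: "proj_point P"
  obtain B where B: "B \<subseteq> P" "vec.independent B" "P \<subseteq> vec.span B" "card B = vec.dim P"
    by (rule vec.basis_exists)
  with P obtain v where v: "B = {v}"
    by (auto simp: proj_point_def card_1_singleton_iff)
  with B have "v \<noteq> 0"
    using vec.dependent_zero[of "{v}"] by auto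
  moreover have "P = vec.span {v}"
    using B v P by (simp add: proj_point_def vec.span_minimal subset_antisym)
  ultimately show "\<exists>v. v \<noteq> 0 \<and> P = vec.span {v}"
    by blast
qed (auto simp: proj_point_def vec.subspace_span)

lemma span_singleton_eq_iff:
  fixes u v :: "'b::field ^ 'n"
  assumes "u \<noteq> 0"
  shows "vec.span {u} = vec.span {v} \<longleftrightarrow> (\<exists>c. c \<noteq> 0 \<and> v = c *s u)"
proof
  assume "vec.span {u} = vec.span {v}"
  then have "v \<in> vec.span {u}" "u \<in> vec.span {v}"
    by (auto intro: vec.span_base)
  then obtain c d where "v = c *s u" "u = d *s v"
    unfolding vec.span_singleton by blast
  with assms show "\<exists>c. c \<noteq> 0 \<and> v = c *s u"
    by (metis vector_smult_lzero vector_smult_rzero)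
next
  assume "\<exists>c. c \<noteq> 0 \<and> v = c *s u"
  then obtain c where c: "c \<noteq> 0" "v = c *s u" by blast
  then have "u \<in> vec.span {v}"
    using vec.span_scale[OF vec.span_base[of v "{v}"], of "inverse c"] by (simp add: vector_smult_assoc)
  moreover have "v \<in> vec.span {u}"
    using c by (simp add: vec.span_base vec.span_scale)
  ultimately show "vec.span {u} = vec.span {v}"
    by (intro subset_antisym vec.span_minimal) auto
qed

lemma span_singleton_uminus: "vec.span {- v} = vec.span {v}" for v :: "'b::field ^ 'n"
proof (cases "v = 0")
  case False
  have "- v = (- 1) *s v"
    by (simp only: vec.scale_minus_left vector_smult_lid)
  with False show ?thesis
    using span_singleton_eq_iff[of v "- v"] by (intro sym[of "vec.span {v}"]) (auto intro!: exI[of _ "- 1"])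
qed simp

lemma matrix_diff_ldistrib: "A ** (B - C) = A ** B - A ** (C :: 'b::field ^ 'n ^ 'm)"
  by (simp add: matrix_eq matrix_vector_mult_diff_rdistrib matrix_vector_mult_diff_distrib
      flip: matrix_vector_mul_assoc)

lemma matrix_diff_rdistrib: "(A - B) ** C = A ** C - B ** (C :: 'b::field ^ 'n ^ 'm)"
  by (simp add: matrix_eq matrix_vector_mult_diff_rdistrib matrix_vector_mult_diff_distrib
      flip: matrix_vector_mul_assoc)

lemma neg_matrix_vector_mult: "(- A) *v x = - (A *v (x :: 'b::field ^ 'n))"
  using matrix_vector_mult_diff_rdistrib[of 0 A x] by simp

lemma matrix_neg_left: "(- A) ** B = - (A ** (B :: 'b::field ^ 'n ^ 'm))"
  using matrix_diff_rdistrib[of 0 A B] by (simp add: matrix_eq flip: matrix_vector_mul_assoc)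

lemma matrix_neg_right: "A ** (- B) = - (A ** (B :: 'b::field ^ 'n ^ 'm))"
  using matrix_diff_ldistrib[of A 0 B] by (simp add: matrix_eq flip: matrix_vector_mul_assoc)

text \<open>The coordinate vectors make \<open>Z\<close> diagonal, and the eigenvector (1, 1) forces
  its two diagonal entries to agree.\<close>

lemma scalar_matrix_if_all_eigenvectors:
  fixes Z :: "'b::field ^ 2 ^ 2"
  assumes "\<And>x. x \<noteq> 0 \<Longrightarrow> \<exists>c. Z *v x = c *s x"
  obtains c where "Z = mat c"
proof -
  obtain a b c where "Z *v vector [1, 0] = a *s vector [1, 0]"
      "Z *v vector [0, 1] = b *s vector [0, 1]" "Z *v vector [1, 1] = c *s vector [1, 1]"
    using assms[of "vector [1, 0]"] assms[of "vector [0, 1]"] assms[of "vector [1, 1]"]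
    by (auto simp: vec_eq_iff forall_2)
  then have "Z = mat c"
    by (simp add: vec_eq_iff forall_2 matrix_vector_mult_def sum_2 mat_def)
  then show thesis by (rule that)
qed

lemma invertible_obtain_inverse:
  assumes "invertible A"
  obtains B where "A ** B = mat 1" "B ** A = mat 1"
  using assms by (auto simp: invertible_def)

lemma mat_mult_vec: "mat c *v x = c *s (x :: 'b::field ^ 'n)"
  by (simp add: vec_eq_iff matrix_vector_mult_def mat_def if_distrib if_distribR cong: if_cong)

lemma mat_mult_comm: "mat c ** Z = Z ** (mat c :: 'b::field ^ 'n ^ 'n)"
  by (simp add: matrix_eq mat_mult_vec vec.scale flip: matrix_vector_mul_assoc)

lemma invertible_ker: "invertible A \<Longrightarrow> A *v x = 0 \<longleftrightarrow> x = 0" for A :: "'b::field ^ 'n ^ 'n"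
  using invertible_left_inverse[of A] matrix_left_invertible_ker[of A] by auto

lemma invertibleI_ker:
  fixes A :: "'b::field ^ 'n ^ 'n"
  shows "(\<And>x. A *v x = 0 \<Longrightarrow> x = 0) \<Longrightarrow> invertible A"
  using invertible_left_inverse matrix_left_invertible_ker by blast

lemma invertible_comm_inverse:
  fixes A B Z :: "'b::field ^ 'n ^ 'n"
  assumes "A ** B = mat 1" "B ** A = mat 1" "A ** Z = Z ** A"
  shows "B ** Z = Z ** B"
proof -
  have "B ** Z = B ** (Z ** A) ** B"
    using assms by (simp flip: matrix_mul_assoc)
  also have "\<dots> = Z ** B"
    using assms by (metis matrix_mul_assoc matrix_mul_lid)
  finally show ?thesis .
qed

text \<open>If \<open>Y\<close> commutes with both \<open>Z\<close> and \<open>1 - Z\<close> up to scalars, then either these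
  scalars are \<open>1\<close> or \<open>Z\<close> is itself scalar.\<close>
lemma commute_if_projectively_commute:
  fixes Z Y :: "'b::field ^ 'n ^ 'n"
  assumes hZ: "Z ** Y = mat c ** (Y ** Z)"
    and hZ1: "(mat 1 - Z) ** Y = mat d ** (Y ** (mat 1 - Z))"
    and Y: "invertible Y"
  shows "Z ** Y = Y ** Z"
proof (cases "c = 1")
  case True
  with hZ show ?thesis by simp
next
  case False
  obtain Y' where Y': "Y' ** Y = mat 1"
    using Y by (rule invertible_obtain_inverse)
  have "Z *v v = ((1 - d) / (c - d)) *s v" if "c \<noteq> d" for v
  proof -
    \<comment> \<open>This is \<open>hZ1\<close> with ZY replaced by cYZ; cancelling Y leaves (c -
      d) Z = 1 - d.\<close>
    have "Y *v v - c *s (Y *v (Z *v v)) = d *s (Y *v v) - d *s (Y *v (Z *v v))"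
      using arg_cong[OF hZ, of "\<lambda>M. M *v v"] arg_cong[OF hZ1, of "\<lambda>M. M *v v"]
      by (simp add: mat_mult_vec matrix_vector_mult_diff_rdistrib matrix_vector_mult_diff_distrib
          vector_ssub_ldistrib flip: matrix_vector_mul_assoc)
    then have "Y *v ((c - d) *s (Z *v v)) = Y *v ((1 - d) *s v)"
      by (simp add: vec.scale algebra_simps vec.scale_left_diff_distrib)
    then have "(c - d) *s (Z *v v) = (1 - d) *s v"
      by (metis Y' matrix_vector_mul_assoc matrix_vector_mul_lid)
    with that show ?thesis
      by (simp add: vec_eq_iff field_simps)
  qed
  \<comment> \<open>If c = d, adding the two relations gives Y = cY, hence c = 1, against the case
    assumption.\<close>
  moreover have "c \<noteq> d"
  proof
    assume "c = d"
    then have "Y *v v = c *s (Y *v v)" for v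
      using arg_cong[OF hZ, of "\<lambda>M. M *v v"] arg_cong[OF hZ1, of "\<lambda>M. M *v v"]
      by (simp add: mat_mult_vec matrix_vector_mult_diff_rdistrib matrix_vector_mult_diff_distrib
          vector_ssub_ldistrib flip: matrix_vector_mul_assoc)
    then have "(1 - c) *s v = 0" for v :: "'b ^ 'n"
      using Y by (metis (no_types, opaque_lifting) eq_iff_diff_eq_0 vec.scale_left_diff_distrib
          invertible_ker vec.scale vector_smult_lid)
    then have "1 - c = 0"
      using vec.scale_eq_0_iff[of "1 - c" "axis undefined (1 :: 'b) :: 'b ^ 'n"] by auto
    with False show False by simp
  qed
  ultimately have "Z = mat ((1 - d) / (c - d))"
    by (simp add: matrix_eq mat_mult_vec)
  then show ?thesis by (simp add: mat_mult_comm)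
qed


section \<open>Coordinates for skew lines\<close>

text \<open>Coordinates adapted to a set \<open>ln ` I\<close> of skew lines: $K^4 = \mathrm{im}\,P \oplus
  \mathrm{im}\,Q$, the line \<open>ln l2\<close> is the image of \<open>Q\<close>, and every other line is the graph
  of a matrix \<open>A i\<close>, with \<open>A l1 = 0\<close> and \<open>A l3 = 1\<close>. The value \<open>A l2\<close> is a dummy
  (the matrix of \<open>ln l2\<close> would be infinite).\<close>

locale graph_lines =
  fixes P Q :: "'b::field ^ 2 ^ 4" and P' Q' :: "'b ^ 4 ^ 2"
    and I :: "'i set" and l1 l2 l3 :: 'i and A :: "'i \<Rightarrow> 'b ^ 2 ^ 2"
    and ln :: "'i \<Rightarrow> ('b ^ 4) set"
  assumes PP: "P' ** P = mat 1" and PQ: "P' ** Q = 0" and QP: "Q' ** P = 0" and QQ: "Q' ** Q = mat 1"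
    and decomp: "P ** P' + Q ** Q' = mat 1"
    and mem: "l1 \<in> I" "l2 \<in> I" "l3 \<in> I"
    and distinct: "l1 \<noteq> l2" "l1 \<noteq> l3" "l2 \<noteq> l3"
    and A_l1: "A l1 = 0" and A_l2: "A l2 = 0" and A_l3: "A l3 = mat 1"
    and ln_l2: "ln l2 = range (\<lambda>x. Q *v x)"
    and ln_graph: "\<And>i. i \<in> I \<Longrightarrow> i \<noteq> l2 \<Longrightarrow> ln i = range (\<lambda>x. P *v x + Q *v (A i *v x))"
    and invertible_diff: "\<And>i j. i \<in> I \<Longrightarrow> j \<in> I \<Longrightarrow> i \<noteq> l2 \<Longrightarrow> j \<noteq> l2 \<Longrightarrow> i \<noteq> j \<Longrightarrow> invertible (A i - A j)"
begin

section \<open>Equations, parametrisations and points of the lines\<close>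

lemma coords [simp]:
  "P' *v (P *v x) = x" "P' *v (Q *v x) = 0" "Q' *v (P *v x) = 0" "Q' *v (Q *v x) = x"
  by (simp_all add: PP PQ QP QQ matrix_vector_mul_assoc)

lemma decomp_vec: "v = P *v (P' *v v) + Q *v (Q' *v v)"
  using arg_cong[OF decomp, of "\<lambda>M. M *v v"]
  by (simp add: matrix_vector_mult_add_rdistrib flip: matrix_vector_mul_assoc)

lemma PQ_eq_0_iff [simp]: "P *v x + Q *v y = 0 \<longleftrightarrow> x = 0 \<and> y = 0"
proof
  assume *: "P *v x + Q *v y = 0"
  from arg_cong[OF *, of "\<lambda>v. P' *v v"] arg_cong[OF *, of "\<lambda>v. Q' *v v"]
  show "x = 0 \<and> y = 0" by (simp add: matrix_vector_right_distrib)
qed auto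

lemma PQ_eq_iff [simp]: "P *v x + Q *v y = P *v x' + Q *v y' \<longleftrightarrow> x = x' \<and> y = y'"
  using PQ_eq_0_iff[of "x - x'" "y - y'"] by (auto simp: matrix_vector_mult_diff_distrib algebra_simps)

text \<open>A parametrisation of each line by K^2. The line \<open>l2\<close>, whose matrix would be
  infinite, is singled out here so that many later arguments are uniform.\<close>

definition emb :: "'i \<Rightarrow> 'b ^ 2 ^ 4" where
  "emb i = (if i = l2 then Q else P + Q ** A i)"

text \<open>Dual to \<open>emb\<close>: two linear equations whose common kernel is the line
  (\<open>mem_iff_eqn\<close>).\<close>

definition eqn :: "'i \<Rightarrow> 'b ^ 4 ^ 2" where
  "eqn i = (if i = l2 then P' else A i ** P' - Q')"

text \<open>The equations of one line evaluated along another; for distinct lines its invertibility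
  expresses skewness.\<close>

definition dmat :: "'i \<Rightarrow> 'i \<Rightarrow> 'b ^ 2 ^ 2" where
  "dmat i j = eqn i ** emb j"

lemma ln_eq_range: "i \<in> I \<Longrightarrow> ln i = range (\<lambda>x. emb i *v x)"
  by (simp add: emb_def ln_l2 ln_graph matrix_vector_mult_add_rdistrib flip: matrix_vector_mul_assoc)

lemma mem_graph_iff: "i \<in> I \<Longrightarrow> i \<noteq> l2 \<Longrightarrow> P *v x + Q *v y \<in> ln i \<longleftrightarrow> y = A i *v x"
  by (auto simp: ln_graph)

lemma mem_l2_iff: "P *v x + Q *v y \<in> ln l2 \<longleftrightarrow> x = 0"
  using PQ_eq_iff[of x y 0] by (auto simp: ln_l2)

lemma mem_iff_eqn:
  assumes "i \<in> I"
  shows "v \<in> ln i \<longleftrightarrow> eqn i *v v = 0"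
proof -
  obtain x y where v: "v = P *v x + Q *v y" using decomp_vec by blast
  show ?thesis
    using assms unfolding v
    by (cases "i = l2") (auto simp: mem_l2_iff mem_graph_iff eqn_def matrix_vector_right_distrib
        matrix_vector_mult_diff_rdistrib simp flip: matrix_vector_mul_assoc)
qed

lemma emb_eq_0_iff [simp]: "emb i *v x = 0 \<longleftrightarrow> x = 0"
  using PQ_eq_0_iff[of x "A i *v x"] PQ_eq_0_iff[of 0 x]
  by (auto simp: emb_def matrix_vector_mult_add_rdistrib simp flip: matrix_vector_mul_assoc)

lemma emb_eq_iff [simp]: "emb i *v x = emb i *v y \<longleftrightarrow> x = y"
  by (metis emb_eq_0_iff eq_iff_diff_eq_0 matrix_vector_mult_diff_distrib)

lemma dmat_vec: "dmat i j *v x = eqn i *v (emb j *v x)"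
  by (simp add: dmat_def matrix_vector_mul_assoc)

lemma dmat_l2_left: "j \<noteq> l2 \<Longrightarrow> dmat l2 j = mat 1"
  by (simp add: matrix_eq dmat_vec emb_def eqn_def matrix_vector_right_distrib
        matrix_vector_mult_add_rdistrib flip: matrix_vector_mul_assoc)

lemma dmat_l2_right: "i \<noteq> l2 \<Longrightarrow> dmat i l2 = - mat 1"
  by (simp add: matrix_eq dmat_vec emb_def eqn_def neg_matrix_vector_mult
        matrix_vector_mult_diff_rdistrib flip: matrix_vector_mul_assoc)

lemma dmat_graph: "i \<noteq> l2 \<Longrightarrow> j \<noteq> l2 \<Longrightarrow> dmat i j = A i - A j"
  by (simp add: matrix_eq dmat_vec emb_def eqn_def matrix_vector_right_distrib
        matrix_vector_mult_diff_rdistrib matrix_vector_mult_add_rdistrib flip: matrix_vector_mul_assoc)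

lemma invertible_dmat:
  assumes "i \<in> I" "j \<in> I" "i \<noteq> j"
  shows "invertible (dmat i j)"
proof -
  have "invertible (mat 1 :: 'b ^ 2 ^ 2)" "invertible (- mat 1 :: 'b ^ 2 ^ 2)"
    by (auto intro!: invertibleI_ker simp: neg_matrix_vector_mult)
  with assms show ?thesis
    by (metis dmat_graph dmat_l2_left dmat_l2_right invertible_diff)
qed

lemma mem_both_iff:
  assumes "i \<in> I" "j \<in> I" "i \<noteq> j"
  shows "v \<in> ln i \<and> v \<in> ln j \<longleftrightarrow> v = 0"
  using assms invertible_dmat[OF assms]
  by (auto simp: mem_iff_eqn[of i] ln_eq_range[of j] invertible_ker simp flip: dmat_vec)

lemma inj_on_ln: "inj_on ln I"
proof
  fix i j assume "i \<in> I" "j \<in> I" "ln i = ln j"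
  moreover have "emb i *v axis 1 1 \<in> ln i" "emb i *v axis 1 1 \<noteq> 0"
    using \<open>i \<in> I\<close> by (auto simp: ln_eq_range)
  ultimately show "i = j"
    using mem_both_iff by metis
qed

lemma subspace_ln: "i \<in> I \<Longrightarrow> vec.subspace (ln i)"
  by (simp add: ln_eq_range vec.subspace_image)

lemma points_ln:
  assumes "i \<in> I"
  shows "p \<in> points (ln i) \<longleftrightarrow> (\<exists>x. x \<noteq> 0 \<and> p = vec.span {emb i *v x})"
proof -
  have sub: "vec.span {v} \<subseteq> ln i \<longleftrightarrow> v \<in> ln i" for v
    using subspace_ln[OF assms]
    by (meson insert_subset vec.span_base vec.span_minimal singletonI empty_subsetI subsetD)
  show ?thesis
  proof
    assume "p \<in> points (ln i)"
    then obtain v where "v \<noteq> 0" "p = vec.span {v}" "v \<in> ln i"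
      unfolding points_def proj_point_iff using sub by blast
    then show "\<exists>x. x \<noteq> 0 \<and> p = vec.span {emb i *v x}"
      unfolding ln_eq_range[OF assms] by force
  next
    assume "\<exists>x. x \<noteq> 0 \<and> p = vec.span {emb i *v x}"
    then obtain x where "x \<noteq> 0" "p = vec.span {emb i *v x}" by blast
    then have "proj_point p"
      unfolding proj_point_iff by (intro exI[of _ "emb i *v x"]) simp
    moreover have "p \<subseteq> ln i"
      using sub[of "emb i *v x"] \<open>p = _\<close> by (simp add: ln_eq_range[OF assms])
    ultimately show "p \<in> points (ln i)"
      by (simp add: points_def)
  qed
qed

lemma span_emb_eq_iff:
  "x \<noteq> 0 \<Longrightarrow> vec.span {emb i *v x} = vec.span {emb i *v y} \<longleftrightarrow> (\<exists>c. c \<noteq> 0 \<and> y = c *s x)"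
proof -
  assume "x \<noteq> 0"
  have "emb i *v y = c *s (emb i *v x) \<longleftrightarrow> y = c *s x" for c
    using emb_eq_iff[of i y "c *s x"] unfolding vec.scale .
  moreover have "emb i *v x \<noteq> 0"
    using \<open>x \<noteq> 0\<close> by simp
  ultimately show ?thesis by (simp add: span_singleton_eq_iff del: emb_eq_0_iff)
qed

text \<open>The equations of \<open>ln k\<close> kill \<open>ln k\<close>, so on the plane they only
  take multiples of the value \<open>dmat k i *v x\<close>. As \<open>dmat k j\<close> is injective,
  the points of \<open>ln j\<close> with such values are the multiples of
  \<open>emb j *v z\<close>.\<close>

lemma projection_coords:
  assumes "i \<in> I" "j \<in> I" "k \<in> I" "i \<noteq> j" "i \<noteq> k" "j \<noteq> k"
    and D: "dmat k j *v z = dmat k i *v x"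
  shows "vec.span (vec.span {emb i *v x} \<union> ln k) \<inter> ln j = vec.span {emb j *v z}"
proof (intro subset_antisym subsetI)
  fix v assume v: "v \<in> vec.span (vec.span {emb i *v x} \<union> ln k) \<inter> ln j"
  moreover have "vec.span (ln k) = ln k"
    by (simp add: vec.span_eq_iff subspace_ln[OF \<open>k \<in> I\<close>])
  ultimately obtain u w where "v = u + w" "u \<in> vec.span {emb i *v x}" "w \<in> ln k"
    unfolding vec.span_Un vec.span_span by blast
  moreover from this(2) obtain c where "u = c *s (emb i *v x)"
    unfolding vec.span_singleton by blast
  ultimately have "eqn k *v v = c *s (dmat k i *v x)"
    using mem_iff_eqn[OF \<open>k \<in> I\<close>] by (simp add: dmat_vec matrix_vector_right_distrib vec.scale)
  moreover obtain y where y: "v = emb j *v y"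
    using v ln_eq_range[OF \<open>j \<in> I\<close>] by blast
  ultimately have "dmat k j *v y = c *s (dmat k i *v x)"
    by (simp add: dmat_vec)
  then have "dmat k j *v (y - c *s z) = 0"
    by (simp add: matrix_vector_mult_diff_distrib vec.scale D)
  then have "y = c *s z"
    using assms invertible_dmat by (simp add: invertible_ker)
  then show "v \<in> vec.span {emb j *v z}"
    by (simp add: y vec.scale vec.span_base vec.span_scale)
next
  fix v assume "v \<in> vec.span {emb j *v z}"
  then obtain c where v: "v = c *s (emb j *v z)" unfolding vec.span_singleton by blast
  have "emb j *v z - emb i *v x \<in> ln k"
    using D mem_iff_eqn[OF \<open>k \<in> I\<close>] by (simp add: matrix_vector_mult_diff_distrib dmat_vec)
  then have "emb i *v x + (emb j *v z - emb i *v x) \<in> vec.span (vec.span {emb i *v x} \<union> ln k)"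
    by (intro vec.span_add) (auto intro: vec.span_base)
  then have "v \<in> vec.span (vec.span {emb i *v x} \<union> ln k)"
    by (simp add: v vec.span_scale)
  moreover have "v \<in> ln j"
    unfolding v using subspace_ln[OF \<open>j \<in> I\<close>] ln_eq_range[OF \<open>j \<in> I\<close>]
    by (intro vec.subspace_scale) auto
  ultimately show "v \<in> vec.span (vec.span {emb i *v x} \<union> ln k) \<inter> ln j" by blast
qed

end


section \<open>The groupoid in coordinates\<close>

locale graph_line_set = graph_lines P Q P' Q' LL l1 l2 l3 A "\<lambda>L. L"
  for P Q :: "'b::field ^ 2 ^ 4" and P' Q' LL l1 l2 l3 A
begin

text \<open>The matrix of an arrow in the coordinates \<open>emb\<close>. It is unique only up to a
  nonzero scalar, as befits PGL_2; extensionality ensures that it determines the arrow.\<close>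

definition represents :: "('b ^ 4) set \<Rightarrow> ('b ^ 4) set \<Rightarrow> (('b ^ 4) set \<Rightarrow> ('b ^ 4) set) \<Rightarrow> 'b ^ 2 ^ 2 \<Rightarrow> bool" where
  "represents i j f B \<longleftrightarrow> f \<in> extensional (points i) \<and> invertible B \<and>
     (\<forall>x. x \<noteq> 0 \<longrightarrow> f (vec.span {emb i *v x}) = vec.span {emb j *v (B *v x)})"

lemma represents_ident: "L \<in> LL \<Longrightarrow> represents L L (\<lambda>p\<in>points L. p) (mat 1)"
  by (auto simp: represents_def points_ln intro: invertibleI_ker)

text \<open>Absorbs the sign that projections to or from \<open>l2\<close> acquire.\<close>

lemma represents_uminus: "represents i j f B \<Longrightarrow> represents i j f (- B)"
proof -
  assume "represents i j f B"
  moreover have "vec.span {emb j *v (- B *v x)} = vec.span {emb j *v (B *v x)}" for x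
    by (simp add: neg_matrix_vector_mult vec.neg span_singleton_uminus)
  moreover have "invertible (- B)" if "invertible B"
    using that by (auto intro!: invertibleI_ker simp: neg_matrix_vector_mult invertible_ker)
  ultimately show ?thesis by (simp add: represents_def)
qed

lemma represents_compose:
  assumes "L \<in> LL" "represents L M f B" "represents M N g C"
  shows "represents L N (compose (points L) g f) (C ** B)"
proof -
  have "compose (points L) g f (vec.span {emb L *v x}) = vec.span {emb N *v ((C ** B) *v x)}"
    if "x \<noteq> 0" for x
  proof -
    have "B *v x \<noteq> 0"
      using assms(2) that by (simp add: represents_def invertible_ker)
    moreover have "vec.span {emb L *v x} \<in> points L"
      using assms(1) that by (auto simp: points_ln)
    ultimately show ?thesis
      using assms(2,3) that by (simp add: represents_def compose_eq flip: matrix_vector_mul_assoc)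
  qed
  with assms(2,3) show ?thesis
    by (simp add: represents_def invertible_mult)
qed

text \<open>This is \<open>projection_coords\<close> for all x at once; the equation for B avoids
  writing the inverse of \<open>dmat N M\<close>.\<close>

lemma represents_line_proj:
  assumes "L \<in> LL" "M \<in> LL" "N \<in> LL" "L \<noteq> M" "L \<noteq> N" "M \<noteq> N"
    and B: "dmat N M ** B = dmat N L"
  shows "represents L M (line_proj L M N) B"
proof -
  have "x = 0" if "B *v x = 0" for x
  proof -
    have "dmat N L *v x = dmat N M *v (B *v x)"
      by (simp only: B matrix_vector_mul_assoc)
    with that show ?thesis
      using invertible_dmat[of N L] assms by (simp add: invertible_ker)
  qed
  then have "invertible B" by (rule invertibleI_ker)
  moreover have "line_proj L M N (vec.span {emb L *v x}) = vec.span {emb M *v (B *v x)}" if "x \<noteq> 0" for x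
  proof -
    have "vec.span {emb L *v x} \<in> points L"
      using assms(1) that by (auto simp: points_ln)
    moreover have "dmat N M *v (B *v x) = dmat N L *v x"
      by (simp add: B matrix_vector_mul_assoc)
    ultimately show ?thesis
      using projection_coords assms by (simp add: line_proj_def)
  qed
  ultimately show ?thesis
    by (simp add: represents_def line_proj_def)
qed

lemma represents_points:
  assumes "L \<in> LL" "M \<in> LL" "represents L M f B" "p \<in> points L"
  shows "f p \<in> points M"
proof -
  obtain x where x: "x \<noteq> 0" "p = vec.span {emb L *v x}"
    using assms points_ln by blast
  then have "B *v x \<noteq> 0" "f p = vec.span {emb M *v (B *v x)}"
    using assms(3) by (auto simp: represents_def invertible_ker)
  then show ?thesis
    using points_ln[OF assms(2)] by blast
qed

lemma represents_inverse:
  assumes "L \<in> LL" "represents L M f B" "represents M L g C" "C ** B = mat 1" "p \<in> points L"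
  shows "g (f p) = p"
proof -
  obtain x where x: "x \<noteq> 0" "p = vec.span {emb L *v x}"
    using assms points_ln by blast
  then have "B *v x \<noteq> 0"
    using assms(2) by (simp add: represents_def invertible_ker)
  moreover have "C *v (B *v x) = x"
    by (simp add: assms(4) matrix_vector_mul_assoc)
  ultimately show ?thesis
    using x assms(2,3) by (simp add: represents_def)
qed

text \<open>This bicommutant stands in for the group generated by the matrices of the projections:
  it contains \<open>dmat i j\<close> for distinct lines, is closed under products and inverses, and
  is commutative once the \<open>A i\<close> commute.\<close>

definition double_centralizer :: "('b ^ 2 ^ 2) set" where
  "double_centralizer = {B. \<forall>C. (\<forall>i\<in>LL. C ** A i = A i ** C) \<longrightarrow> B ** C = C ** B}"

lemma double_centralizer_mult:
  "B \<in> double_centralizer \<Longrightarrow> C \<in> double_centralizer \<Longrightarrow> B ** C \<in> double_centralizer"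
  unfolding double_centralizer_def mem_Collect_eq by (metis matrix_mul_assoc)

lemma double_centralizer_inverse:
  assumes "B \<in> double_centralizer" "B ** C = mat 1"
  shows "C \<in> double_centralizer"
proof -
  have "C ** B = mat 1"
    using assms matrix_left_right_inverse by blast
  with assms show ?thesis
    using invertible_comm_inverse[of B C] by (simp add: double_centralizer_def)
qed

lemma dmat_in_double_centralizer:
  assumes "i \<in> LL" "j \<in> LL" "i \<noteq> j"
  shows "dmat i j \<in> double_centralizer"
proof -
  have "- mat 1 ** C = C ** - mat 1" for C :: "'b ^ 2 ^ 2"
    by (simp add: matrix_eq neg_matrix_vector_mult vec.neg flip: matrix_vector_mul_assoc)
  then have "mat 1 \<in> double_centralizer" "- mat 1 \<in> double_centralizer"
    unfolding double_centralizer_def by simp_all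
  moreover have "A i - A j \<in> double_centralizer"
    using assms by (simp add: double_centralizer_def matrix_diff_ldistrib matrix_diff_rdistrib)
  moreover have "dmat i j = mat 1 \<or> dmat i j = - mat 1 \<or> dmat i j = A i - A j"
    using assms dmat_graph dmat_l2_left dmat_l2_right by metis
  ultimately show ?thesis by metis
qed

text \<open>Each \<open>A i\<close> centralizes all of them, so C commutes with each
  \<open>A i\<close>; this makes C an admissible test matrix for B.\<close>

lemma double_centralizer_commute:
  assumes "\<And>i j. i \<in> LL \<Longrightarrow> j \<in> LL \<Longrightarrow> A i ** A j = A j ** A i"
    and "B \<in> double_centralizer" "C \<in> double_centralizer"
  shows "B ** C = C ** B"
proof -
  have "C ** A i = A i ** C" if "i \<in> LL" for i
    using assms that by (simp add: double_centralizer_def)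
  then show ?thesis
    using assms(2) by (simp add: double_centralizer_def)
qed

text \<open>The induction carries a reverse arrow along, since the rules for \<open>arrow\<close>
  contain no inverses: a projection from N is undone by the projection back from N.\<close>

lemma arrow_representation:
  assumes "arrow LL L M f"
  shows "L \<in> LL \<and> M \<in> LL \<and> (\<exists>g B C. represents L M f B \<and> arrow LL M L g \<and> represents M L g C \<and>
    C ** B = mat 1 \<and> B \<in> double_centralizer)"
  using assms
proof induction
  case (ident L)
  moreover have "mat 1 \<in> double_centralizer"
    by (simp add: double_centralizer_def)
  ultimately show ?case
    using arrow.ident represents_ident matrix_mul_lid by blast
next
  case (proj L M N)
  obtain B' where B': "dmat N M ** B' = mat 1" "B' ** dmat N M = mat 1"
    using invertible_dmat[of N M] proj by (auto elim: invertible_obtain_inverse)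
  obtain C' where C': "dmat N L ** C' = mat 1" "C' ** dmat N L = mat 1"
    using invertible_dmat[of N L] proj by (auto elim: invertible_obtain_inverse)
  have "represents L M (line_proj L M N) (B' ** dmat N L)"
    using proj B' by (intro represents_line_proj) (auto simp: matrix_mul_assoc)
  moreover have "represents M L (line_proj M L N) (C' ** dmat N M)"
    using proj C' by (intro represents_line_proj) (auto simp: matrix_mul_assoc)
  moreover have "(C' ** dmat N M) ** (B' ** dmat N L) = mat 1"
    using B' C' by (metis matrix_mul_assoc matrix_mul_rid)
  moreover have "B' ** dmat N L \<in> double_centralizer"
    using proj B' by (intro double_centralizer_mult dmat_in_double_centralizer
        double_centralizer_inverse[of "dmat N M"]) auto
  ultimately show ?case
    using proj arrow.proj[of M LL L N] by blast
next
  case (comp L M f N g)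
  then obtain f' B C g' B1 C1 where *: "represents L M f B" "arrow LL M L f'" "represents M L f' C"
    "C ** B = mat 1" "B \<in> double_centralizer" "represents M N g B1" "arrow LL N M g'"
    "represents N M g' C1" "C1 ** B1 = mat 1" "B1 \<in> double_centralizer" by blast
  then have "(C ** C1) ** (B1 ** B) = mat 1"
    by (metis matrix_mul_assoc matrix_mul_rid)
  moreover note represents_compose[of L M f B N g B1] represents_compose[of N M g' C1 L f' C]
    arrow.comp[of LL N M g' L f'] double_centralizer_mult[of B1 B]
  ultimately show ?case
    using comp * by blast
qed

section \<open>The groups at the lines\<close>

lemma arrow_in_Bij:
  assumes "arrow LL L L f"
  obtains g where "f \<in> Bij (points L)" "g \<in> Bij (points L)" "arrow LL L L g"
    "compose (points L) g f = (\<lambda>p\<in>points L. p)"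
proof -
  obtain g B C where *: "L \<in> LL" "represents L L f B" "represents L L g C" "C ** B = mat 1" "arrow LL L L g"
    using arrow_representation[OF assms] by blast
  \<comment> \<open>For square matrices a left inverse is a right inverse, so f and g undo each
    other on both sides.\<close>
  have "B ** C = mat 1"
    using * matrix_left_right_inverse by blast
  then have "g (f p) = p" "f (g p) = p" "f p \<in> points L" "g p \<in> points L" if "p \<in> points L" for p
    using * that represents_inverse[of L L f B g C p] represents_inverse[of L L g C f B p]
      represents_points[of L L f B p] represents_points[of L L g C p] by simp_all
  moreover from this have "bij_betw f (points L) (points L)"
    by (intro bij_betw_byWitness[of _ g]) (simp_all add: image_subset_iff)
  moreover have "bij_betw g (points L) (points L)"
    using calculation(1-4) by (intro bij_betw_byWitness[of _ f]) (simp_all add: image_subset_iff)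
  moreover have "f \<in> extensional (points L)" "g \<in> extensional (points L)"
    using * by (simp_all add: represents_def)
  ultimately show thesis
    using * by (intro that[of g]) (simp_all add: Bij_def compose_def cong: restrict_cong)
qed

lemma group_line_group:
  assumes "L \<in> LL"
  shows "group (line_group LL L)"
proof -
  interpret group "BijGroup (points L)" by (rule group_BijGroup)
  have mult: "g \<otimes>\<^bsub>BijGroup (points L)\<^esub> f = compose (points L) g f"
    if "arrow LL L L f" "arrow LL L L g" for f g
    using arrow_in_Bij[OF that(1)] arrow_in_Bij[OF that(2)] by (auto simp: BijGroup_def)
  have "subgroup {f. arrow LL L L f} (BijGroup (points L))"
  proof (rule subgroupI)
    show "{f. arrow LL L L f} \<subseteq> carrier (BijGroup (points L))"
      using arrow_in_Bij by (force simp: BijGroup_def)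
    show "{f. arrow LL L L f} \<noteq> {}"
      using assms arrow.ident by blast
  next
    fix f assume "f \<in> {f. arrow LL L L f}"
    then obtain g where g: "f \<in> Bij (points L)" "g \<in> Bij (points L)" "arrow LL L L g"
        "compose (points L) g f = (\<lambda>p\<in>points L. p)"
      by (auto elim: arrow_in_Bij)
    then have "inv\<^bsub>BijGroup (points L)\<^esub> f = g"
      by (intro inv_equality) (auto simp: BijGroup_def)
    with g show "inv\<^bsub>BijGroup (points L)\<^esub> f \<in> {f. arrow LL L L f}" by simp
  next
    fix f g assume "f \<in> {f. arrow LL L L f}" "g \<in> {f. arrow LL L L f}"
    then show "f \<otimes>\<^bsub>BijGroup (points L)\<^esub> g \<in> {f. arrow LL L L f}"
      by (auto simp: mult intro: arrow.comp)
  qed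
  then show ?thesis
    unfolding line_group_def by (rule subgroup.subgroup_is_group) (rule group_BijGroup)
qed

lemma line_group_mult:
  assumes "arrow LL L L f" "arrow LL L L g"
  shows "g \<otimes>\<^bsub>line_group LL L\<^esub> f = compose (points L) g f"
  using arrow_in_Bij[OF assms(1)] arrow_in_Bij[OF assms(2)]
  by (auto simp: line_group_def BijGroup_def)

lemma comm_line_group_if_commute:
  assumes L: "L \<in> LL" and comm: "\<And>i j. i \<in> LL \<Longrightarrow> j \<in> LL \<Longrightarrow> A i ** A j = A j ** A i"
  shows "comm_group (line_group LL L)"
proof -
  have "compose (points L) f g = compose (points L) g f" if fg: "arrow LL L L f" "arrow LL L L g" for f g
  proof -
    obtain B C where "represents L L f B" "B \<in> double_centralizer"
        "represents L L g C" "C \<in> double_centralizer"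
      using arrow_representation[OF fg(1)] arrow_representation[OF fg(2)] by blast
    \<comment> \<open>Both composites have the same matrix, and a matrix determines the
      arrow.\<close>
    then have "represents L L (compose (points L) f g) (B ** C)"
        "represents L L (compose (points L) g f) (B ** C)"
      using represents_compose L double_centralizer_commute[OF comm] by metis+
    then have "compose (points L) f g p = compose (points L) g f p" if "p \<in> points L" for p
      using that points_ln[OF L] by (auto simp: represents_def)
    then show ?thesis
      by (auto simp: compose_def fun_eq_iff)
  qed
  then have "f \<otimes>\<^bsub>line_group LL L\<^esub> g = g \<otimes>\<^bsub>line_group LL L\<^esub> f"
    if "f \<in> carrier (line_group LL L)" "g \<in> carrier (line_group LL L)" for f g
    using that line_group_mult[of L] by (simp add: line_group_def)
  then show ?thesis
    using group_line_group[OF L] by (intro group.group_comm_groupI) auto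
qed

section \<open>From an abelian group back to commuting matrices\<close>

definition arrow_matrix :: "('b ^ 4) set \<Rightarrow> ('b ^ 4) set \<Rightarrow> 'b ^ 2 ^ 2 \<Rightarrow> bool" where
  "arrow_matrix L M B \<longleftrightarrow> (\<exists>f. arrow LL L M f \<and> represents L M f B)"

lemma arrow_matrix_compose:
  "arrow_matrix L M B \<Longrightarrow> arrow_matrix M N C \<Longrightarrow> arrow_matrix L N (C ** B)"
  unfolding arrow_matrix_def using arrow.comp represents_compose arrow_representation by metis

lemma arrow_matrix_proj:
  assumes "L \<in> LL" "M \<in> LL" "N \<in> LL" "L \<noteq> M" "L \<noteq> N" "M \<noteq> N" "dmat N M ** B = dmat N L"
  shows "arrow_matrix L M B"
  unfolding arrow_matrix_def using represents_line_proj[OF assms] arrow.proj[OF assms(1-6)] by blast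

lemma arrow_matrix_uminus: "arrow_matrix L M (- B) \<Longrightarrow> arrow_matrix L M B"
  unfolding arrow_matrix_def using represents_uminus by fastforce

text \<open>The identifications of the lines with K^2 are themselves arrows. Between distinct graph
  lines, project from \<open>l2\<close>; between \<open>l1\<close> and \<open>l2\<close>, project
  from \<open>l3\<close>, which has matrix -1.\<close>

lemma arrow_matrix_id:
  assumes "L \<in> LL" "M \<in> LL"
  shows "arrow_matrix L M (mat 1)"
proof -
  have self: "arrow_matrix L L (mat 1)" if "L \<in> LL" for L
    using arrow.ident[OF that] represents_ident[OF that] unfolding arrow_matrix_def by blast
  have graph: "arrow_matrix L M (mat 1)" if "L \<in> LL" "M \<in> LL" "L \<noteq> l2" "M \<noteq> l2" for L M
  proof (cases "L = M")
    case False
    with that mem show ?thesis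
      by (intro arrow_matrix_proj[of _ _ l2]) (auto simp: dmat_l2_left)
  qed (use self that in simp)
  have d: "dmat l3 l2 = - mat 1" "dmat l3 l1 = mat 1"
    using distinct by (simp_all add: dmat_l2_right dmat_graph A_l1 A_l3)
  have l12: "arrow_matrix l1 l2 (mat 1)"
    by (rule arrow_matrix_uminus, rule arrow_matrix_proj[of _ _ l3])
      (use mem distinct d in \<open>simp_all add: matrix_neg_left matrix_neg_right\<close>)
  have l21: "arrow_matrix l2 l1 (mat 1)"
    by (rule arrow_matrix_uminus, rule arrow_matrix_proj[of _ _ l3])
      (use mem distinct d in simp_all)
  have "arrow_matrix L l1 (mat 1)" "arrow_matrix l1 M (mat 1)"
    using assms mem distinct graph l12 l21 by metis+
  then show ?thesis
    using arrow_matrix_compose by fastforce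
qed

text \<open>Composing with identity matrices at both ends transports any matrix; with
  \<open>L' = M'\<close> every arrow gives an element of one fixed group.\<close>

lemma arrow_matrix_conj:
  assumes "L \<in> LL" "M \<in> LL" "L' \<in> LL" "M' \<in> LL" "arrow_matrix L M B"
  shows "arrow_matrix L' M' B"
  using arrow_matrix_compose[OF arrow_matrix_compose[OF arrow_matrix_id[of L' L]] arrow_matrix_id[of M M']] assms
  by simp

text \<open>Commuting arrows only give commuting classes modulo scalars: the inverse of CB times BC
  fixes every point, hence is scalar.\<close>

lemma arrow_matrices_commute:
  assumes "comm_group (line_group LL L)" "L \<in> LL" "arrow_matrix L L B" "arrow_matrix L L C"
  obtains c where "B ** C = mat c ** (C ** B)"
proof -
  obtain f g where f: "arrow LL L L f" "represents L L f B" and g: "arrow LL L L g" "represents L L g C"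
    using assms unfolding arrow_matrix_def by blast
  interpret comm_group "line_group LL L" by fact
  have "f \<otimes>\<^bsub>line_group LL L\<^esub> g = g \<otimes>\<^bsub>line_group LL L\<^esub> f"
    using f g by (intro m_comm) (auto simp: line_group_def)
  then have eq: "compose (points L) f g = compose (points L) g f"
    using f g by (simp add: line_group_mult)
  have fg: "represents L L (compose (points L) f g) (B ** C)"
    and gf: "represents L L (compose (points L) f g) (C ** B)"
    using represents_compose[OF assms(2)] f g eq by (force, force)
  obtain Z where Z: "(C ** B) ** Z = mat 1" "Z ** (C ** B) = mat 1"
    using gf by (auto simp: represents_def elim: invertible_obtain_inverse)
  have "\<exists>c. (Z ** (B ** C)) *v x = c *s x" if "x \<noteq> 0" for x
  proof -
    have "(C ** B) *v x \<noteq> 0"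
      using gf that by (simp add: represents_def invertible_ker)
    moreover have "vec.span {emb L *v ((C ** B) *v x)} = vec.span {emb L *v ((B ** C) *v x)}"
      using fg gf that by (simp add: represents_def)
    ultimately obtain c where "(B ** C) *v x = c *s ((C ** B) *v x)"
      using span_emb_eq_iff by metis
    then have "Z *v ((B ** C) *v x) = c *s (Z *v ((C ** B) *v x))"
      by (simp add: vec.scale)
    then show ?thesis
      using Z by (auto simp: matrix_vector_mul_assoc)
  qed
  then obtain c where "Z ** (B ** C) = mat c"
    by (rule scalar_matrix_if_all_eigenvectors)
  then have "(C ** B) ** (Z ** (B ** C)) = (C ** B) ** mat c"
    by simp
  then show thesis
    using Z that by (metis mat_mult_comm matrix_mul_assoc matrix_mul_lid)
qed

text \<open>Projecting \<open>l1\<close> to \<open>l2\<close> from k has matrix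
  \<open>- A k\<close>, and projecting \<open>l1\<close> to i from \<open>l3\<close> has the inverse
  of 1 - \<open>A i\<close>. So \<open>A j\<close> commutes up to scalars with both
  \<open>A i\<close> and 1 - \<open>A i\<close>, and \<open>commute_if_projectively_commute\<close>
  applies.\<close>

lemma commute_if_comm_line_group:
  assumes comm: "comm_group (line_group LL L)" and L: "L \<in> LL" and ij: "i \<in> LL" "j \<in> LL"
  shows "A i ** A j = A j ** A i"
proof (cases "i \<in> {l1, l2, l3} \<or> j \<in> {l1, l2}")
  case True
  then show ?thesis
    by (auto simp: A_l1 A_l2 A_l3 matrix_eq simp flip: matrix_vector_mul_assoc)
next
  case False
  have loop: "arrow_matrix L L (A k)" if "k \<in> LL" "k \<noteq> l1" "k \<noteq> l2" for k
  proof (rule arrow_matrix_conj)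
    show "arrow_matrix l1 l2 (A k)"
      by (rule arrow_matrix_uminus, rule arrow_matrix_proj[of _ _ k])
        (use that mem distinct in \<open>simp_all add: dmat_l2_right dmat_graph A_l1 matrix_neg_left matrix_neg_right\<close>)
  qed (use mem L in auto)
  have inv: "invertible (A k)" if "k \<in> LL" "k \<noteq> l1" "k \<noteq> l2" for k
    using invertible_diff[of k l1] that mem distinct by (simp add: A_l1)
  obtain Z where Z: "(mat 1 - A i) ** Z = mat 1" "Z ** (mat 1 - A i) = mat 1"
    using invertible_diff[of l3 i] False ij mem distinct by (auto simp: A_l3 elim: invertible_obtain_inverse)
  have "arrow_matrix L L Z"
  proof (rule arrow_matrix_conj)
    show "arrow_matrix l1 i Z"
      by (rule arrow_matrix_proj[of _ _ l3])
        (use False mem distinct ij Z in \<open>simp_all add: dmat_graph A_l1 A_l3 eq_commute[of l1]\<close>)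
  qed (use mem L ij in auto)
  then obtain d where d: "A j ** Z = mat d ** (Z ** A j)"
    using arrow_matrices_commute[OF comm L] loop False ij by blast
  \<comment> \<open>Multiplying the relation for the inverse Z on both sides by 1 -
    \<open>A i\<close> turns it into one for 1 - \<open>A i\<close>.\<close>
  have "((mat 1 - A i) ** A j) ** (Z ** (mat 1 - A i)) = (mat 1 - A i) ** (A j ** Z) ** (mat 1 - A i)"
    by (simp only: matrix_mul_assoc)
  also have "\<dots> = (mat 1 - A i) ** (mat d ** (Z ** A j)) ** (mat 1 - A i)"
    by (simp only: d)
  also have "\<dots> = mat d ** (((mat 1 - A i) ** Z) ** (A j ** (mat 1 - A i)))"
    by (simp only: mat_mult_comm[of d "mat 1 - A i"] matrix_mul_assoc)
  finally have "(mat 1 - A i) ** A j = mat d ** (A j ** (mat 1 - A i))"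
    by (simp only: Z matrix_mul_lid matrix_mul_rid)
  moreover obtain c where "A i ** A j = mat c ** (A j ** A i)"
    using arrow_matrices_commute[OF comm L] loop False ij by blast
  ultimately show ?thesis
    using commute_if_projectively_commute inv False ij by blast
qed

end


section \<open>Existence of coordinates\<close>

text \<open>The intersection being zero, the sum has dimension 2 + 2 = 4 and fills the
  space.\<close>

lemma skew_decomp:
  assumes "proj_line L" "proj_line M" "skew L M"
  obtains l m where "l \<in> L" "m \<in> M" "v = l + m"
proof -
  let ?S = "{x + y |x y. x \<in> L \<and> y \<in> M}"
  have "vec.dim ?S = 4"
    using vec.dim_sums_Int[of L M] assms by (simp add: proj_line_def skew_def vec.dim_eq_0)
  then have "vec.span ?S = UNIV"
    using vec.dim_eq_full[of ?S] by (simp add: vec.dimension_def card_cart_basis)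
  moreover have "vec.span ?S = ?S"
    using assms by (intro vec.span_eq_iff[THEN iffD2] vec.subspace_sums) (simp_all add: proj_line_def)
  ultimately have "v \<in> ?S" by blast
  then show thesis using that by blast
qed

lemma skew_unique:
  assumes "vec.subspace N" "vec.subspace M" "skew N M"
    and "n \<in> N" "n' \<in> N" "u + n \<in> M" "u + n' \<in> M"
  shows "n = n'"
proof -
  have "n - n' \<in> N" "(u + n) - (u + n') \<in> M"
    using assms by (blast intro: vec.subspace_diff)+
  then have "n - n' \<in> N \<inter> M" by simp
  with assms show ?thesis by (simp add: skew_def)
qed

lemma linear_matrix:
  fixes f :: "'b::field ^ 'n \<Rightarrow> 'b ^ 'm"
  assumes "\<And>x y. f (x + y) = f x + f y" "\<And>c x. f (c *s x) = c *s f x"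
  obtains B where "\<And>x. B *v x = f x"
proof -
  have "Vector_Spaces.linear (*s) (*s) f"
    by unfold_locales (simp_all add: assms)
  then show thesis
    using that[of "matrix f"] by (simp add: matrix_works)
qed

text \<open>Each P x can be moved onto M by a correction in N; skewness makes the correction unique,
  hence linear in x.\<close>

lemma graph_matrix:
  fixes P :: "'b::field ^ 2 ^ 4"
  assumes "proj_line N" "proj_line M" "skew N M"
  obtains B where "\<And>x. B *v x \<in> N" "\<And>x. P *v x + B *v x \<in> M"
proof -
  have sub: "vec.subspace N" "vec.subspace M"
    using assms by (simp_all add: proj_line_def)
  have "\<exists>n. n \<in> N \<and> P *v x + n \<in> M" for x
  proof -
    obtain n m where "n \<in> N" "m \<in> M" "P *v x = n + m"
      using skew_decomp[OF assms] .
    then have "- n \<in> N \<and> P *v x + (- n) \<in> M"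
      using sub by (simp add: vec.subspace_neg)
    then show ?thesis ..
  qed
  then obtain f where f: "f x \<in> N" "P *v x + f x \<in> M" for x by metis
  have add: "f (x + y) = f x + f y" for x y
  proof -
    have "(P *v x + f x) + (P *v y + f y) \<in> M"
      using f sub by (simp add: vec.subspace_add)
    then have "P *v (x + y) + (f x + f y) \<in> M"
      by (simp add: matrix_vector_right_distrib algebra_simps)
    then show ?thesis
      using f sub by (intro skew_unique[OF sub assms(3), of _ _ "P *v (x + y)"]) (auto intro: vec.subspace_add)
  qed
  have scale: "f (c *s x) = c *s f x" for c x
  proof -
    have "c *s (P *v x + f x) \<in> M"
      using f(2) sub(2) by (intro vec.subspace_scale)
    then have "P *v (c *s x) + c *s f x \<in> M"
      by (simp add: vec.scale vec.scale_right_distrib)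
    then show ?thesis
      using f sub by (intro skew_unique[OF sub assms(3), of _ _ "P *v (c *s x)"]) (auto intro: vec.subspace_scale)
  qed
  obtain B where "\<And>x. B *v x = f x"
    using linear_matrix[of f] add scale by blast
  with f that[of B] show thesis by simp
qed

lemma complement_coordinates:
  fixes P Q :: "'b::field ^ 2 ^ 4"
  assumes surj: "\<And>v. \<exists>x y. v = P *v x + Q *v y"
    and inj: "\<And>x y. P *v x + Q *v y = 0 \<Longrightarrow> x = 0 \<and> y = 0"
  obtains P' Q' where "P' ** P = mat 1" "P' ** Q = 0" "Q' ** P = 0" "Q' ** Q = mat 1"
    "P ** P' + Q ** Q' = mat 1"
proof -
  obtain p q where pq: "v = P *v p v + Q *v q v" for v
    using surj by metis
  have eq: "x = x' \<and> y = y'" if "P *v x + Q *v y = P *v x' + Q *v y'" for x y x' y'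
    using inj[of "x - x'" "y - y'"] that by (simp add: matrix_vector_mult_diff_distrib algebra_simps)
  have add: "p (u + v) = p u + p v \<and> q (u + v) = q u + q v" for u v
  proof (rule eq)
    have "P *v p (u + v) + Q *v q (u + v) = (P *v p u + Q *v q u) + (P *v p v + Q *v q v)"
      using pq by metis
    then show "P *v p (u + v) + Q *v q (u + v) = P *v (p u + p v) + Q *v (q u + q v)"
      by (simp add: matrix_vector_right_distrib)
  qed
  have scale: "p (c *s v) = c *s p v \<and> q (c *s v) = c *s q v" for c v
  proof (rule eq)
    have "P *v p (c *s v) + Q *v q (c *s v) = c *s (P *v p v + Q *v q v)"
      using pq by metis
    then show "P *v p (c *s v) + Q *v q (c *s v) = P *v (c *s p v) + Q *v (c *s q v)"
      by (simp add: vec.scale vec.scale_right_distrib)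
  qed
  obtain P' where P': "\<And>x. P' *v x = p x"
    using linear_matrix[of p] add scale by blast
  obtain Q' where Q': "\<And>x. Q' *v x = q x"
    using linear_matrix[of q] add scale by blast
  have "p (P *v x) = x \<and> q (P *v x) = 0" "p (Q *v x) = 0 \<and> q (Q *v x) = x" for x
    using eq[of "p (P *v x)" "q (P *v x)" x 0] eq[of "p (Q *v x)" "q (Q *v x)" 0 x] pq by auto
  then show thesis
    using pq by (intro that[of P' Q']) (simp_all add: matrix_eq P' Q' matrix_vector_mult_add_rdistrib
        flip: matrix_vector_mul_assoc)
qed

text \<open>Any basis of \<open>l1\<close> gives P. The basis of \<open>l2\<close> is then adjusted
  to it: Q x is the correction moving P x onto \<open>l3\<close>, so that \<open>l3\<close> becomes
  the graph of 1.\<close>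

lemma skew_lines_graph_coordinates:
  fixes LL :: "('b::field ^ 4) set set"
  assumes LL: "skew_lines LL" and mem: "l1 \<in> LL" "l2 \<in> LL" "l3 \<in> LL"
    and distinct: "l1 \<noteq> l2" "l1 \<noteq> l3" "l2 \<noteq> l3"
  obtains P Q P' Q' A where "graph_line_set P Q P' Q' LL l1 l2 l3 A"
proof -
  have line: "proj_line M" if "M \<in> LL" for M
    using LL that by (simp add: skew_lines_def)
  have sub: "vec.subspace M" if "M \<in> LL" for M
    using line[OF that] by (simp add: proj_line_def)
  have skew: "skew M N" if "M \<in> LL" "N \<in> LL" "M \<noteq> N" for M N
    using LL that by (simp add: skew_lines_def pairwise_def)
  have eq0: "v = 0" if "M \<in> LL" "N \<in> LL" "M \<noteq> N" "v \<in> M" "v \<in> N" for M N v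
    using skew[OF that(1-3)] that by (auto simp: skew_def)
  have "vec.dim (UNIV :: ('b ^ 2) set) = vec.dim l1"
    using line[OF mem(1)] unfolding proj_line_def vec_dim_card by simp
  then obtain f :: "'b ^ 2 \<Rightarrow> 'b ^ 4" where f: "Vector_Spaces.linear (*s) (*s) f" "range f = l1" "inj f"
    using vec.subspace_isomorphism[OF vec.subspace_UNIV sub[OF mem(1)]] by metis
  define P where "P = matrix f"
  have P: "P *v x = f x" for x
    using f(1) by (simp add: P_def matrix_works)
  have P0: "P *v x = 0 \<Longrightarrow> x = 0" for x
    using injD[OF f(3), of x 0] by (simp add: flip: P)
  obtain Q where Q: "Q *v x \<in> l2" "P *v x + Q *v x \<in> l3" for x
    using graph_matrix[OF line line skew, of l2 l3 P] mem distinct by metis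
  have Q0: "x = 0" if "Q *v x = 0" for x
    using Q(2)[of x] that eq0[of l1 l3 "P *v x"] mem distinct f(2) P P0 by auto
  have ran_Q: "\<exists>x. y = Q *v x" if y: "y \<in> l2" for y
  proof -
    \<comment> \<open>Splitting y along \<open>l1\<close> and \<open>l3\<close> yields x with P x +
      y on \<open>l3\<close>; uniqueness of the correction gives y = Q x.\<close>
    obtain l m where lm: "l \<in> l1" "m \<in> l3" "y = l + m"
      using skew_decomp[OF line line skew, of l1 l3] mem distinct by metis
    then obtain x where "l = - P *v x"
      using f(2) P vec.neg[of P] by (metis minus_minus neg_matrix_vector_mult rangeE)
    then have "P *v x + y \<in> l3"
      using lm by (simp add: neg_matrix_vector_mult)
    then have "y = Q *v x"
      using skew_unique[OF sub sub skew, of l2 l3 y "Q *v x" "P *v x"] y Q mem distinct by blast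
    then show ?thesis ..
  qed
  have inj: "x = 0 \<and> y = 0" if "P *v x + Q *v y = 0" for x y
  proof -
    have "P *v x = - (Q *v y)"
      using that by (simp add: eq_neg_iff_add_eq_0)
    then have "P *v x \<in> l2"
      using Q(1)[of y] sub[OF mem(2)] by (simp add: vec.subspace_neg)
    moreover have "P *v x \<in> l1"
      using f(2) P by auto
    ultimately have "P *v x = 0"
      using eq0[of l1 l2] mem distinct by blast
    with that show ?thesis
      using P0 Q0 by simp
  qed
  have surj: "\<exists>x y. v = P *v x + Q *v y" for v
  proof -
    obtain l m where "l \<in> l1" "m \<in> l2" "v = l + m"
      using skew_decomp[OF line line skew, of l1 l2] mem distinct by metis
    with f(2) P ran_Q show ?thesis by (metis rangeE)
  qed
  obtain P' Q' where PQ: "P' ** P = mat 1" "P' ** Q = 0" "Q' ** P = 0" "Q' ** Q = mat 1"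
      "P ** P' + Q ** Q' = mat 1"
    using complement_coordinates[OF surj inj] by metis
  have "\<exists>A. \<forall>x. P *v x + Q *v (A *v x) \<in> M" if M: "M \<in> LL" "M \<noteq> l2" for M
  proof -
    obtain B where B: "B *v x \<in> l2" "P *v x + B *v x \<in> M" for x
      using graph_matrix[OF line line skew, of l2 M P] mem M by metis
    \<comment> \<open>The matrix sought is Q' B: QQ' is the identity on \<open>l2\<close>, where B
      takes its values.\<close>
    have "Q *v ((Q' ** B) *v x) = B *v x" for x
    proof -
      obtain y where y: "B *v x = Q *v y"
        using ran_Q B by blast
      have "Q' *v (Q *v y) = y"
        by (simp add: PQ matrix_vector_mul_assoc)
      then show ?thesis
        by (simp add: y flip: matrix_vector_mul_assoc)
    qed
    with B show ?thesis by metis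
  qed
  then obtain A' where A': "P *v x + Q *v (A' M *v x) \<in> M" if "M \<in> LL" "M \<noteq> l2" for M x
    by metis
  have unique: "y = A' M *v x" if "M \<in> LL" "M \<noteq> l2" "P *v x + Q *v y \<in> M" for M x y
  proof -
    have "Q *v y = Q *v (A' M *v x)"
      using skew_unique[OF sub sub skew, of l2 M "Q *v y" "Q *v (A' M *v x)" "P *v x"] that Q(1) A' mem by blast
    then have "Q *v (y - A' M *v x) = 0"
      by (simp add: matrix_vector_mult_diff_distrib)
    then show ?thesis
      using Q0 by fastforce
  qed
  define A where "A = A'(l2 := 0)"
  have "graph_line_set P Q P' Q' LL l1 l2 l3 A"
  proof
    have "P *v x + Q *v 0 \<in> l1" for x
      using f(2) P by auto
    then have "A l1 *v x = 0" for x
      using unique[of l1 x 0] mem distinct by (simp add: A_def)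
    then show "A l1 = 0" by (simp add: matrix_eq)
    have "A l3 *v x = x" for x
      using unique[of l3 x x] Q(2) mem distinct by (simp add: A_def)
    then show "A l3 = mat 1" by (simp add: matrix_eq)
    show "l2 = range (\<lambda>x. Q *v x)"
      using Q(1) ran_Q by blast
    show "i = range (\<lambda>x. P *v x + Q *v (A i *v x))" if "i \<in> LL" "i \<noteq> l2" for i
    proof (intro subset_antisym subsetI)
      fix v assume "v \<in> i"
      moreover obtain x y where "v = P *v x + Q *v y"
        using surj by blast
      ultimately show "v \<in> range (\<lambda>x. P *v x + Q *v (A i *v x))"
        using unique[OF that] that by (auto simp: A_def)
    qed (use A' that in \<open>auto simp: A_def\<close>)
    show "invertible (A i - A j)" if "i \<in> LL" "j \<in> LL" "i \<noteq> l2" "j \<noteq> l2" "i \<noteq> j" for i j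
    proof (rule invertibleI_ker)
      \<comment> \<open>A kernel vector yields a common point of the skew lines i and j.\<close>
      fix x assume "(A i - A j) *v x = 0"
      then have "A i *v x = A j *v x"
        by (simp add: matrix_vector_mult_diff_rdistrib)
      then have "P *v x + Q *v (A i *v x) = 0"
        using A'[of i x] A'[of j x] that eq0[of i j] by (simp add: A_def)
      then show "x = 0" using inj by blast
    qed
  qed (use PQ mem distinct in \<open>auto simp: A_def\<close>)
  then show thesis by (rule that)
qed


section \<open>Commuting 2-by-2 matrices\<close>

text \<open>A bilinear test for proportionality that also covers zero vectors. In the coordinates
  (x, y) it is the equation of the quadric through the first three lines.\<close>

definition det2 :: "'b::field ^ 2 \<Rightarrow> 'b ^ 2 \<Rightarrow> 'b" where
  "det2 x y = x $ 1 * y $ 2 - x $ 2 * y $ 1"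

lemma det2_simps [simp]:
  "det2 x 0 = 0" "det2 0 x = 0" "det2 x x = 0"
  "det2 (x + x') y = det2 x y + det2 x' y" "det2 x (y + y') = det2 x y + det2 x y'"
  "det2 (x - x') y = det2 x y - det2 x' y" "det2 x (y - y') = det2 x y - det2 x y'"
  "det2 (c *s x) y = c * det2 x y" "det2 x (c *s y) = c * det2 x y"
  by (simp_all add: det2_def algebra_simps)

lemma det2_swap: "det2 x y = - det2 y x"
  by (simp add: det2_def)

lemma det2_eq_0_iff:
  assumes "u \<noteq> 0"
  shows "det2 u v = 0 \<longleftrightarrow> (\<exists>c. v = c *s u)"
proof
  assume *: "det2 u v = 0"
  show "\<exists>c. v = c *s u"
  proof (cases "u $ 1 = 0")
    case True
    with assms have "u $ 2 \<noteq> 0" by (auto simp: vec_eq_iff forall_2)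
    with True * have "v = (v $ 2 / u $ 2) *s u"
      by (simp add: vec_eq_iff forall_2 det2_def)
    then show ?thesis ..
  next
    case False
    with * have "v = (v $ 1 / u $ 1) *s u"
      by (simp add: vec_eq_iff forall_2 det2_def field_simps)
    then show ?thesis ..
  qed
qed auto

text \<open>Cramer's rule.\<close>

lemma basis2:
  assumes "det2 u v \<noteq> 0"
  obtains a b where "x = a *s u + b *s v"
proof
  have "det2 u v * x $ i = det2 x v * u $ i + det2 u x * v $ i" for i
    using exhaust_2[of i] by (auto simp: det2_def algebra_simps)
  then show "x = (det2 x v / det2 u v) *s u + (det2 u x / det2 u v) *s v"
    using assms by (simp add: vec_eq_iff field_simps)
qed

lemma matrix2_eqI:
  fixes M N :: "'b::field ^ 2 ^ 2"
  assumes "det2 u v \<noteq> 0" "M *v u = N *v u" "M *v v = N *v v"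
  shows "M = N"
  unfolding matrix_eq
proof
  fix x
  obtain a b where "x = a *s u + b *s v"
    using basis2[OF assms(1)] .
  with assms(2,3) show "M *v x = N *v x"
    by (simp add: matrix_vector_right_distrib vec.scale)
qed

definition common_eigenvector :: "('b::field ^ 2 ^ 2) set \<Rightarrow> 'b ^ 2 \<Rightarrow> bool" where
  "common_eigenvector S u \<longleftrightarrow> u \<noteq> 0 \<and> (\<forall>M\<in>S. \<exists>a. M *v u = a *s u)"

text \<open>All matrices of \<open>S\<close> are of the form \<open>a + b N\<close> for a fixed \<open>N\<close> with kernel and image
  spanned by \<open>u\<close>.\<close>
definition common_jordan_vector :: "('b::field ^ 2 ^ 2) set \<Rightarrow> 'b ^ 2 \<Rightarrow> bool" where
  "common_jordan_vector S u \<longleftrightarrow>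
     u \<noteq> 0 \<and> (\<forall>M\<in>S. \<exists>a. M *v u = a *s u \<and> (\<forall>x. det2 u (M *v x - a *s x) = 0))"

lemma commute_if_two_eigenvectors:
  assumes "common_eigenvector S u" "common_eigenvector S v" "det2 u v \<noteq> 0" "M \<in> S" "N \<in> S"
  shows "M ** N = N ** M"
proof (rule matrix2_eqI[OF assms(3)])
  have "(M ** N) *v w = (N ** M) *v w" if w: "common_eigenvector S w" for w
  proof -
    obtain a b where "M *v w = a *s w" "N *v w = b *s w"
      using w assms unfolding common_eigenvector_def by meson
    then show ?thesis
      by (simp add: vec.scale vector_smult_assoc mult.commute flip: matrix_vector_mul_assoc)
  qed
  with assms show "(M ** N) *v u = (N ** M) *v u" "(M ** N) *v v = (N ** M) *v v" by blast+
qed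

text \<open>For fixed x write M x = a x + s u and N x = b x + t u; both products give ab x + (at +
  bs) u.\<close>

lemma commute_if_common_jordan_vector:
  assumes "common_jordan_vector S u" "M \<in> S" "N \<in> S"
  shows "M ** N = N ** M"
  unfolding matrix_eq
proof
  fix x
  obtain a b where ab: "M *v u = a *s u" "N *v u = b *s u"
      "det2 u (M *v x - a *s x) = 0" "det2 u (N *v x - b *s x) = 0"
    using assms unfolding common_jordan_vector_def by metis
  with assms obtain s t where "M *v x - a *s x = s *s u" "N *v x - b *s x = t *s u"
    by (auto simp: common_jordan_vector_def det2_eq_0_iff simp del: det2_simps)
  then have "M *v x = a *s x + s *s u" "N *v x = b *s x + t *s u"
    by (simp_all add: diff_eq_eq add.commute)
  with ab show "(M ** N) *v x = (N ** M) *v x"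
    by (simp add: matrix_vector_right_distrib vec.scale vec.scale_right_distrib vector_smult_assoc
        mult.commute add.assoc add.left_commute flip: matrix_vector_mul_assoc)
qed

lemma eigenvector_exists:
  fixes M :: "'b::alg_closed_field ^ 2 ^ 2"
  obtains a u where "u \<noteq> 0" "M *v u = a *s u"
proof -
  \<comment> \<open>The coefficients of the characteristic polynomial: determinant, minus trace,
    1.\<close>
  define f where "f k = (if k = 0 then det M else if k = 1 then - (M $ 1 $ 1 + M $ 2 $ 2) else 1)" for k :: nat
  obtain a where "(\<Sum>k\<le>2. f k * a ^ k) = 0"
    using alg_closed[of 2 f] by (auto simp: f_def)
  then have "det (M - mat a) = 0"
    by (simp add: f_def det_2 mat_def numeral_2_eq_2 algebra_simps)
  then have "\<not> invertible (M - mat a)"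
    by (simp add: invertible_det_nz)
  then obtain u where "u \<noteq> 0" "(M - mat a) *v u = 0"
    using invertibleI_ker by blast
  then show thesis
    using that[of u a] by (simp add: matrix_vector_mult_diff_rdistrib mat_mult_vec)
qed

text \<open>For a non-scalar M with eigenvalue a, kernel and image of B = M - a are lines preserved
  by every matrix of S. If they differ, they are two common eigenlines; if they coincide, B is
  nilpotent and the Jordan case arises.\<close>

lemma commuting_matrices_cases:
  fixes S :: "('b::alg_closed_field ^ 2 ^ 2) set"
  assumes comm: "\<And>M N. M \<in> S \<Longrightarrow> N \<in> S \<Longrightarrow> M ** N = N ** M"
  obtains (diagonal) u v where "common_eigenvector S u" "common_eigenvector S v" "det2 u v \<noteq> 0"
    | (jordan) u M where "common_jordan_vector S u" "M \<in> S" "\<And>a. M \<noteq> mat a"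
proof (cases "\<forall>M\<in>S. \<exists>a. M = mat a")
  case True
  show thesis
  proof (rule diagonal)
    show "common_eigenvector S (vector [1, 0])" "common_eigenvector S (vector [0, 1])"
      using True by (fastforce simp: common_eigenvector_def mat_mult_vec vec_eq_iff[of _ 0] forall_2)+
    show "det2 (vector [1, 0]) (vector [0, 1] :: 'b ^ 2) \<noteq> 0"
      by (simp add: det2_def)
  qed
next
  case False
  then obtain M where M: "M \<in> S" "\<And>a. M \<noteq> mat a" by blast
  obtain a u where u: "u \<noteq> 0" "M *v u = a *s u"
    by (rule eigenvector_exists)
  define B where "B = M - mat a"
  have B: "B *v x = M *v x - a *s x" for x
    by (simp add: B_def matrix_vector_mult_diff_rdistrib mat_mult_vec)
  have Bu: "B *v u = 0"
    by (simp add: B u)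
  have BN: "B *v (N *v x) = N *v (B *v x)" if "N \<in> S" for N x
  proof -
    have "B ** N = N ** B"
      using comm[OF M(1) that] by (simp add: B_def matrix_diff_ldistrib matrix_diff_rdistrib mat_mult_comm)
    then show ?thesis by (simp add: matrix_vector_mul_assoc)
  qed
  obtain y where y: "B *v y \<noteq> 0"
    using M(2)[of a] by (auto simp: B_def matrix_eq matrix_vector_mult_diff_rdistrib)
  have uy: "det2 u y \<noteq> 0"
    using y Bu by (auto simp: det2_eq_0_iff[OF u(1)] vec.scale simp del: det2_simps)
  obtain \<alpha> \<beta> where By: "B *v y = \<alpha> *s u + \<beta> *s y"
    by (rule basis2[OF uy])
  \<comment> \<open>N commutes with B and so preserves its kernel, the line of u.\<close>
  have eig: "\<exists>c. N *v u = c *s u" if "N \<in> S" for N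
  proof -
    obtain c d where cd: "N *v u = c *s u + d *s y"
      by (rule basis2[OF uy])
    have "d *s (B *v y) = B *v (N *v u)"
      by (simp add: cd matrix_vector_right_distrib vec.scale Bu)
    also have "\<dots> = 0"
      by (simp add: BN[OF that] Bu)
    finally have "d = 0" using y by simp
    with cd show ?thesis by auto
  qed
  \<comment> \<open>B identifies K^2 modulo u with its image, so N acts on both by the same scalar
    d.\<close>
  have Ny: "\<exists>c d. N *v y = c *s u + d *s y \<and> N *v (B *v y) = d *s (B *v y)" if "N \<in> S" for N
  proof -
    obtain c d where cd: "N *v y = c *s u + d *s y"
      by (rule basis2[OF uy])
    then have "N *v (B *v y) = d *s (B *v y)"
      by (simp add: matrix_vector_right_distrib vec.scale Bu flip: BN[OF that])
    with cd show ?thesis by blast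
  qed
  show thesis
  proof (cases "\<beta> = 0")
    case False
    \<comment> \<open>Here B y is an eigenvector of B for the nonzero \<beta>, hence independent of
      u, which B kills.\<close>
    have "B *v (B *v y) = B *v (\<alpha> *s u + \<beta> *s y)"
      by (simp only: By)
    also have "\<dots> = \<beta> *s (B *v y)"
      by (simp add: matrix_vector_right_distrib vec.scale Bu)
    finally have "B *v (B *v y) \<noteq> 0"
      using False y by simp
    then have "det2 u (B *v y) \<noteq> 0"
      using Bu by (auto simp: det2_eq_0_iff[OF u(1)] vec.scale simp del: det2_simps)
    moreover have "common_eigenvector S u" "common_eigenvector S (B *v y)"
      using u(1) eig y Ny by (auto simp: common_eigenvector_def)
    ultimately show thesis by (intro diagonal)
  next
    case True
    have "\<alpha> \<noteq> 0"
      using y By True by auto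
    have "\<exists>d. N *v u = d *s u \<and> (\<forall>x. det2 u (N *v x - d *s x) = 0)" if N: "N \<in> S" for N
    proof -
      obtain c d where cd: "N *v y = c *s u + d *s y" "N *v (B *v y) = d *s (B *v y)"
        using Ny[OF N] by blast
      \<comment> \<open>Now B y is a multiple of u, so d is also the eigenvalue of N on u, and N - d
        maps into the span of u.\<close>
      then have "\<alpha> *s (N *v u) = \<alpha> *s (d *s u)"
        by (simp add: By True vec.scale vector_smult_assoc mult.commute)
      then have Nu: "N *v u = d *s u"
        using \<open>\<alpha> \<noteq> 0\<close> vec.scale_left_imp_eq by blast
      have "det2 u (N *v x - d *s x) = 0" for x
      proof -
        obtain s t where "x = s *s u + t *s y"
          by (rule basis2[OF uy])
        then show ?thesis
          by (simp add: matrix_vector_right_distrib vec.scale Nu cd algebra_simps)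
      qed
      with Nu show ?thesis by blast
    qed
    then show thesis
      using u(1) M by (intro jordan) (auto simp: common_jordan_vector_def)
  qed
qed


section \<open>Transversals and quadrics in coordinates\<close>

lemma det2_all_imp_scalar:
  assumes "\<And>x. det2 x (M *v x) = 0"
  obtains a where "M = mat a"
proof (rule scalar_matrix_if_all_eigenvectors)
  fix x :: "'a ^ 2" assume "x \<noteq> 0"
  with assms[of x] show "\<exists>c. M *v x = c *s x"
    by (simp add: det2_eq_0_iff)
qed

lemma span_insert2: "vec.span {u, v} = {a *s u + b *s v |a b. True}" for u v :: "'b::field ^ 'n"
proof -
  have "x \<in> vec.span {u, v} \<longleftrightarrow> (\<exists>a b. x = a *s u + b *s v)" for x
    unfolding vec.span_breakdown_eq[of x u] vec.span_singleton
    by (simp add: image_iff diff_eq_eq) (metis add.commute)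
  then show ?thesis by blast
qed

lemma subspace_dim2_eq:
  fixes T T' :: "('b::field ^ 4) set"
  assumes "proj_line T" "proj_line T'" "T \<subseteq> T'"
  shows "T = T'"
  using assms vec.subspace_dim_equal[of T T'] by (simp add: proj_line_def)

section \<open>Transversals as common eigenlines\<close>

context graph_lines
begin

text \<open>For nonzero u, the line joining the points with coordinates u on \<open>l1\<close> and
  \<open>l2\<close>; it meets \<open>l3\<close> in P u + Q u. These lines are the opposite ruling of
  the quadric through the three lines.\<close>

definition trans_line :: "'b ^ 2 \<Rightarrow> ('b ^ 4) set" where
  "trans_line u = vec.span {P *v u, Q *v u}"

lemma mem_trans_line: "P *v x + Q *v y \<in> trans_line u \<longleftrightarrow> (\<exists>a b. x = a *s u \<and> y = b *s u)"
proof -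
  have "P *v x + Q *v y \<in> trans_line u \<longleftrightarrow> (\<exists>a b. P *v x + Q *v y = P *v (a *s u) + Q *v (b *s u))"
    unfolding trans_line_def span_insert2 vec.scale by blast
  then show ?thesis by simp
qed

lemma proj_line_span:
  assumes "x \<noteq> 0" "y \<noteq> 0"
  shows "proj_line (vec.span {P *v x, Q *v y})"
proof -
  have ne: "P *v x \<noteq> 0" "Q *v y \<noteq> 0"
    using assms PQ_eq_0_iff[of x 0] PQ_eq_0_iff[of 0 y] by auto
  have "P *v x \<noteq> c *s (Q *v y)" for c
    using assms PQ_eq_iff[of x 0 0 "c *s y"] by (auto simp: vec.scale simp del: PQ_eq_iff)
  then have "P *v x \<notin> vec.span {Q *v y}"
    unfolding vec.span_singleton by blast
  then have "P *v x \<noteq> Q *v y" "vec.independent {P *v x, Q *v y}"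
    using ne by (auto simp: vec.independent_insert vec.span_base)
  then show ?thesis
    using vec.dim_eq_card_independent[of "{P *v x, Q *v y}"] by (simp add: proj_line_def)
qed

lemma trans_line_inj:
  assumes "trans_line u = trans_line v" "u \<noteq> 0"
  shows "det2 u v = 0"
proof -
  have "P *v v + Q *v 0 \<in> trans_line u"
    unfolding assms(1) mem_trans_line by (intro exI[of _ 1] exI[of _ 0]) simp
  then show ?thesis
    unfolding mem_trans_line det2_eq_0_iff[OF assms(2)] by blast
qed

text \<open>Meeting \<open>l1\<close>, \<open>l2\<close>, \<open>l3\<close> forces T to be some
  \<open>trans_line w\<close>; such a line meets the graph of \<open>A i\<close> exactly when w is
  an eigenvector of \<open>A i\<close>.\<close>

lemma transversal_iff:
  "transversal (ln ` I) T \<longleftrightarrow> (\<exists>u. T = trans_line u \<and> common_eigenvector (A ` I) u)"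
proof
  assume "\<exists>u. T = trans_line u \<and> common_eigenvector (A ` I) u"
  then obtain u where u: "T = trans_line u" "u \<noteq> 0" "\<And>i. i \<in> I \<Longrightarrow> \<exists>a. A i *v u = a *s u"
    by (auto simp: common_eigenvector_def)
  have "ln i \<inter> T \<noteq> {0}" if i: "i \<in> I" for i
  proof (cases "i = l2")
    case True
    have "P *v 0 + Q *v u \<in> ln i \<inter> T"
      unfolding mem_trans_line u(1) True Int_iff mem_l2_iff
      by (auto intro!: exI[of _ 0] exI[of _ 1])
    moreover have "P *v 0 + Q *v u \<noteq> 0"
      using u(2) PQ_eq_0_iff by blast
    ultimately show ?thesis by blast
  next
    case False
    obtain a where a: "A i *v u = a *s u"
      using u(3)[OF i] by blast
    have "P *v u + Q *v (a *s u) \<in> ln i \<inter> T"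
      unfolding u(1) mem_trans_line Int_iff mem_graph_iff[OF i False] a
      by (auto intro!: exI[of _ 1])
    moreover have "P *v u + Q *v (a *s u) \<noteq> 0"
      using u(2) PQ_eq_0_iff by blast
    ultimately show ?thesis by blast
  qed
  then show "transversal (ln ` I) T"
    using u(1,2) by (simp add: transversal_def trans_line_def proj_line_span)
next
  assume T: "transversal (ln ` I) T"
  then have sub: "vec.subspace T" and line: "proj_line T"
    by (simp_all add: transversal_def proj_line_def)
  have meet: "\<exists>t. t \<in> ln i \<and> t \<in> T \<and> t \<noteq> 0" if "i \<in> I" for i
  proof -
    have "0 \<in> ln i \<inter> T"
      using subspace_ln[OF that] sub by (simp add: vec.subspace_0)
    moreover have "ln i \<inter> T \<noteq> {0}"
      using T that by (simp add: transversal_def)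
    ultimately show ?thesis by blast
  qed
  obtain x where x: "P *v x \<in> T" "x \<noteq> 0"
    using meet[OF mem(1)] PQ_eq_0_iff[of _ 0] distinct mem by (auto simp: ln_graph A_l1)
  obtain y where y: "Q *v y \<in> T" "y \<noteq> 0"
    using meet[OF mem(2)] PQ_eq_0_iff[of 0] by (auto simp: ln_l2)
  obtain w where w: "P *v w + Q *v w \<in> T" "w \<noteq> 0"
    using meet[OF mem(3)] distinct mem by (auto simp: ln_graph A_l3)
  have "vec.span {P *v x, Q *v y} = T"
    using x y sub line by (intro subspace_dim2_eq proj_line_span vec.span_minimal) auto
  \<comment> \<open>The point of T on \<open>l3\<close> is a combination of those on
    \<open>l1\<close> and \<open>l2\<close>, so w is a multiple of both x and y.\<close>
  then obtain a b where "P *v w + Q *v w = P *v (a *s x) + Q *v (b *s y)"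
    using w unfolding span_insert2 vec.scale by blast
  then have ab: "w = a *s x" "w = b *s y"
    by auto
  have "P *v w \<in> T" "Q *v w \<in> T"
    using x(1) y(1) sub vec.scale[of P a x] vec.scale[of Q b y] ab by (auto intro: vec.subspace_scale)
  then have T_eq: "trans_line w = T"
    unfolding trans_line_def using w sub line
    by (intro subspace_dim2_eq proj_line_span vec.span_minimal) auto
  have "\<exists>c. A i *v w = c *s w" if i: "i \<in> I" for i
  proof (cases "i = l2")
    case False
    obtain t where t: "t \<in> ln i" "t \<in> T" "t \<noteq> 0"
      using meet[OF i] by blast
    then obtain z where z: "t = P *v z + Q *v (A i *v z)"
      using ln_graph[OF i False] by blast
    then have "P *v z + Q *v (A i *v z) \<in> trans_line w"
      using t(2) T_eq by simp
    then obtain c d where cd: "z = c *s w" "A i *v z = d *s w"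
      unfolding mem_trans_line by blast
    \<comment> \<open>Otherwise z, and with it the point t, would vanish.\<close>
    have "c \<noteq> 0"
      using t z cd by auto
    have "c *s (A i *v w) = d *s w"
      using cd by (simp add: vec.scale)
    with \<open>c \<noteq> 0\<close> have "A i *v w = (d / c) *s w"
      by (simp add: vec_eq_iff field_simps)
    then show ?thesis ..
  qed (auto simp: A_l2 intro: exI[of _ 0])
  with w T_eq show "\<exists>u. T = trans_line u \<and> common_eigenvector (A ` I) u"
    by (auto simp: common_eigenvector_def)
qed

end

text \<open>Written with \<open>quad_grad\<close> to match the expression in
  \<open>tangent_at\<close>; \<open>quad_form_add\<close> identifies it as the polarization in every
  characteristic.\<close>

definition polar :: "'b::alg_closed_field ^ 4 ^ 4 \<Rightarrow> 'b ^ 4 \<Rightarrow> 'b ^ 4 \<Rightarrow> 'b" where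
  "polar S v w = (\<Sum>i\<in>UNIV. quad_grad S v $ i * w $ i)"

lemma quad_form_add: "quad_form S (v + w) = quad_form S v + quad_form S w + polar S v w"
  by (simp add: quad_form_def polar_def quad_grad_def matrix_vector_mult_def transpose_def sum_4 algebra_simps)

lemma quad_form_scale: "quad_form S (c *s v) = c ^ 2 * quad_form S v"
  by (simp add: quad_form_def sum_distrib_left power2_eq_square mult_ac)

lemma polar_eq: "polar S v w = quad_form S (v + w) - quad_form S v - quad_form S w"
  by (simp add: quad_form_add)

lemma polar_swap: "polar S v w = polar S w v"
  by (simp add: polar_eq add.commute)

lemma polar_add_right: "polar S v (w + w') = polar S v w + polar S v w'"
  by (simp add: polar_def distrib_left sum.distrib)

lemma polar_scale_right: "polar S v (c *s w) = c * polar S v w"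
  by (simp add: polar_def sum_distrib_left mult_ac)

lemma polar_add_left: "polar S (v + v') w = polar S v w + polar S v' w"
  by (simp add: polar_swap[of S _ w] polar_add_right)

lemma polar_scale_left: "polar S (c *s v) w = c * polar S v w"
  by (simp add: polar_swap[of S _ w] polar_scale_right)

lemma quad_grad_eq_0_iff: "quad_grad S v = 0 \<longleftrightarrow> (\<forall>w. polar S v w = 0)"
proof
  assume *: "\<forall>w. polar S v w = 0"
  have "quad_grad S v $ i = polar S v (axis i 1)" for i
    by (simp add: polar_def axis_def if_distrib cong: if_cong)
  with * show "quad_grad S v = 0" by (simp add: vec_eq_iff)
qed (simp add: polar_def)

section \<open>The quadric through three lines and tangency to it\<close>

locale graph_lines_closed = graph_lines P Q P' Q' I l1 l2 l3 A ln
  for P Q :: "'b::alg_closed_field ^ 2 ^ 4" and P' Q' and I :: "'i set" and l1 l2 l3 A ln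
begin

text \<open>The quadric through \<open>ln l1\<close>, \<open>ln l2\<close>, \<open>ln l3\<close> consists of the vectors \<open>P x + Q y\<close> with
  proportional \<open>x\<close> and \<open>y\<close>.\<close>
lemma quadric_form:
  assumes smooth: "smooth_quadric S"
    and "in_quadric (ln l1) S" "in_quadric (ln l2) S" "in_quadric (ln l3) S"
  obtains c where "c \<noteq> 0" "\<And>x y. quad_form S (P *v x + Q *v y) = c * det2 x y"
proof -
  have PP0: "quad_form S (P *v x) = 0" and QQ0: "quad_form S (Q *v x) = 0"
      and PQ0: "quad_form S (P *v x + Q *v x) = 0" for x
    using assms(2-4) mem distinct by (auto simp: in_quadric_def ln_l2 ln_graph A_l1 A_l3)
  \<comment> \<open>Vanishing on \<open>l1\<close> and \<open>l2\<close> leaves only this bilinear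
    part, and vanishing on \<open>l3\<close> makes it alternating, hence a multiple of
    \<open>det2\<close>.\<close>
  define b where "b x y = polar S (P *v x) (Q *v y)" for x y
  have b_simps: "b (x + x') y = b x y + b x' y" "b x (y + y') = b x y + b x y'"
      "b (c *s x) y = c * b x y" "b x (c *s y) = c * b x y" for x x' y y' c
    by (simp_all add: b_def matrix_vector_right_distrib vec.scale polar_add_left polar_add_right
        polar_scale_left polar_scale_right)
  have form: "quad_form S (P *v x + Q *v y) = b x y" for x y
    by (simp add: b_def quad_form_add PP0 QQ0)
  then have alt: "b x x = 0" for x
    using PQ0 by metis
  define e f :: "'b ^ 2" where "e = vector [1, 0]" and "f = vector [0, 1]"
  have ef: "b f e = - b e f"
    using alt[of "e + f"] unfolding b_simps by (simp add: alt eq_neg_iff_add_eq_0 add.commute)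
  have exp: "b x y = b e f * det2 x y" for x y
  proof -
    have "x = x $ 1 *s e + x $ 2 *s f" "y = y $ 1 *s e + y $ 2 *s f"
      by (simp_all add: e_def f_def vec_eq_iff forall_2)
    then have "b x y = b (x $ 1 *s e + x $ 2 *s f) (y $ 1 *s e + y $ 2 *s f)"
      by metis
    also have "\<dots> = b e f * det2 x y"
      by (simp add: b_simps alt ef det2_def algebra_simps)
    finally show ?thesis .
  qed
  \<comment> \<open>If the constant were 0, the form would vanish identically and every point, such
    as Q e, would be singular.\<close>
  have "b e f \<noteq> 0"
  proof
    assume 0: "b e f = 0"
    have "quad_form S (P *v x + Q *v y) = 0" for x y
      unfolding form by (subst exp) (simp add: 0)
    then have "quad_form S v = 0" for v
      using decomp_vec[of v] by metis
    then have "quad_grad S (Q *v e) = 0" "quad_form S (Q *v e) = 0"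
      by (simp_all add: quad_grad_eq_0_iff polar_eq)
    moreover have "Q *v e \<noteq> 0"
      using PQ_eq_0_iff[of 0 e] by (simp add: e_def vec_eq_iff forall_2)
    ultimately show False
      using smooth by (auto simp: smooth_quadric_def)
  qed
  moreover have "quad_form S (P *v x + Q *v y) = b e f * det2 x y" for x y
    unfolding form by (rule exp)
  ultimately show thesis by (rule that)
qed

lemma polar_frame:
  assumes "\<And>x y. quad_form S (P *v x + Q *v y) = c * det2 x y"
  shows "polar S (P *v x + Q *v y) (P *v x' + Q *v y') = c * (det2 x y' + det2 x' y)"
proof -
  have "P *v x + Q *v y + (P *v x' + Q *v y') = P *v (x + x') + Q *v (y + y')"
    by (simp add: matrix_vector_right_distrib add_ac)
  then show ?thesis
    unfolding polar_eq by (simp only: assms) (simp add: algebra_simps)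
qed

text \<open>By \<open>quadric_form\<close>, containment makes \<open>A i *v x\<close> proportional
  to x for every x.\<close>

lemma scalar_if_in_quadric:
  assumes "smooth_quadric S" "in_quadric (ln l1) S" "in_quadric (ln l2) S" "in_quadric (ln l3) S"
    and i: "i \<in> I" "i \<noteq> l2" "in_quadric (ln i) S"
  obtains a where "A i = mat a"
proof -
  obtain c where c: "c \<noteq> 0" "\<And>x y. quad_form S (P *v x + Q *v y) = c * det2 x y"
    using quadric_form[OF assms(1-4)] by blast
  have "det2 x (A i *v x) = 0" for x
  proof -
    have "P *v x + Q *v (A i *v x) \<in> ln i"
      using i by (simp add: mem_graph_iff)
    then show ?thesis
      using i(3) c by (auto simp: in_quadric_def)
  qed
  then show thesis
    using det2_all_imp_scalar that by metis
qed

text \<open>Lines on the quadric have scalar matrices. For the others, with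
  \<open>A i *v u = a *s u\<close>, tangency at P u + a Q u says that \<open>A i\<close> - a maps
  into the span of u. So u is a common Jordan vector.\<close>

lemma commute_if_tangent:
  assumes T: "transversal (ln ` I) T"
    and S: "smooth_quadric S" "in_quadric (ln l1) S" "in_quadric (ln l2) S" "in_quadric (ln l3) S"
    and tangent: "\<And>i. i \<in> I \<Longrightarrow> in_quadric (ln i) S \<or> tangent_at (ln i) S (ln i \<inter> T)"
    and ij: "i \<in> I" "j \<in> I"
  shows "A i ** A j = A j ** A i"
proof -
  obtain u where u: "T = trans_line u" "common_eigenvector (A ` I) u"
    using T transversal_iff by blast
  obtain c where c: "c \<noteq> 0" "\<And>x y. quad_form S (P *v x + Q *v y) = c * det2 x y"
    using quadric_form[OF S] by blast
  have "\<exists>a. A i *v u = a *s u \<and> (\<forall>x. det2 u (A i *v x - a *s x) = 0)" if i: "i \<in> I" for i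
  proof (cases "i = l2 \<or> in_quadric (ln i) S")
    case True
    then obtain a where "A i = mat a"
      using scalar_if_in_quadric[OF S i] A_l2 by (metis mat_0)
    then show ?thesis by (auto simp: mat_mult_vec)
  next
    case False
    obtain a where a: "A i *v u = a *s u"
      using u i by (auto simp: common_eigenvector_def)
    have "P *v u + Q *v (a *s u) \<in> ln i \<inter> T"
      using i False a by (auto simp: u(1) mem_trans_line mem_graph_iff intro!: exI[of _ 1])
    moreover have "P *v x + Q *v (A i *v x) \<in> ln i" for x
      using i False by (simp add: mem_graph_iff)
    ultimately have "polar S (P *v u + Q *v (a *s u)) (P *v x + Q *v (A i *v x)) = 0" for x
      using tangent[OF i] False unfolding tangent_at_def polar_def by blast
    then have "det2 u (A i *v x) + det2 x (a *s u) = 0" for x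
      using c(1) unfolding polar_frame[OF c(2)] by simp
    then have "det2 u (A i *v x - a *s x) = 0" for x
      using det2_swap[of x u] by (metis (no_types) add_uminus_conv_diff det2_simps(7,9) mult_minus_right)
    with a show ?thesis by blast
  qed
  then have "common_jordan_vector (A ` I) u"
    using u(2) by (auto simp: common_jordan_vector_def common_eigenvector_def)
  with ij show ?thesis
    using commute_if_common_jordan_vector by blast
qed

text \<open>The non-scalar \<open>A i0\<close> supplies a fourth line and rules out a common smooth
  quadric; the Jordan condition is precisely tangency along the transversal.\<close>

lemma double_transversal_if_jordan:
  assumes fin: "finite I" and u: "common_jordan_vector (A ` I) u"
    and i0: "i0 \<in> I" "\<And>a. A i0 \<noteq> mat a"
  shows "double_transversal (ln ` I) (trans_line u)"
  unfolding double_transversal_def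
proof (intro conjI)
  have i0_ne: "i0 \<noteq> l1" "i0 \<noteq> l2" "i0 \<noteq> l3"
    using i0(2) A_l1 A_l2 A_l3 by (metis mat_0)+
  then have "card {l1, l2, l3, i0} = 4"
    using distinct by auto
  moreover have "card {l1, l2, l3, i0} \<le> card I"
    using fin mem i0 by (intro card_mono) auto
  ultimately show "4 \<le> card (ln ` I)"
    by (simp add: card_image inj_on_ln)
  have u0: "u \<noteq> 0"
    using u by (simp add: common_jordan_vector_def)
  show "transversal (ln ` I) (trans_line u)"
    unfolding transversal_iff
    using u unfolding common_jordan_vector_def common_eigenvector_def by blast
  show "\<not> (\<exists>S. smooth_quadric S \<and> (\<forall>L\<in>ln ` I. in_quadric L S))"
    using scalar_if_in_quadric[of _ i0] mem i0 i0_ne by (metis imageI)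
  \<comment> \<open>The matrix of the form taking P x + Q y to \<open>det2 x y\<close>, left
    unsymmetrized so as to work in characteristic 2.\<close>
  define S :: "'b ^ 4 ^ 4" where
    "S = (\<chi> i j. P' $ 1 $ i * Q' $ 2 $ j - P' $ 2 $ i * Q' $ 1 $ j)"
  have form: "quad_form S v = det2 (P' *v v) (Q' *v v)" for v
    by (simp add: S_def quad_form_def det2_def matrix_vector_mult_def sum_4 algebra_simps)
  have PQform: "quad_form S (P *v x + Q *v y) = 1 * det2 x y" for x y
    by (simp add: form matrix_vector_right_distrib)
  have "smooth_quadric S"
    unfolding smooth_quadric_def
  proof (intro allI impI notI)
    fix v assume v: "v \<noteq> 0 \<and> quad_form S v = 0" "quad_grad S v = 0"
    obtain x y where xy: "v = P *v x + Q *v y"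
      using decomp_vec by blast
    have "det2 x y' + det2 x' y = 0" for x' y'
      using v(2) polar_frame[OF PQform] unfolding quad_grad_eq_0_iff xy by (metis mult_1)
    \<comment> \<open>Setting one test vector to 0 separates the conditions on x and y.\<close>
    from this[of _ 0] this[of 0] have "det2 x' y = 0" "det2 x y' = 0" for x' y'
      by simp_all
    from this(1)[of "vector [1, 0]"] this(1)[of "vector [0, 1]"]
      this(2)[of "vector [1, 0]"] this(2)[of "vector [0, 1]"]
    have "x = 0" "y = 0"
      by (simp_all add: det2_def vec_eq_iff forall_2)
    with xy v show False by simp
  qed
  moreover have "in_quadric (ln l1) S" "in_quadric (ln l2) S" "in_quadric (ln l3) S"
    using PQform[of _ 0] PQform[of 0] PQform mem distinct
    by (auto simp: in_quadric_def ln_l2 ln_graph A_l1 A_l3)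
  moreover have "in_quadric (ln i) S \<or> tangent_at (ln i) S (ln i \<inter> trans_line u)" if i: "i \<in> I" for i
  proof (cases "i = l2")
    case False
    obtain d where d: "A i *v u = d *s u" "\<And>x. det2 u (A i *v x - d *s x) = 0"
      using u i unfolding common_jordan_vector_def by blast
    define p where "p = P *v u + Q *v (d *s u)"
    have "p \<noteq> 0"
      using u0 by (simp add: p_def)
    have scale_p: "c *s p = P *v (c *s u) + Q *v (c *s (d *s u))" for c
      by (simp add: p_def vec.scale vec.scale_right_distrib)
    \<comment> \<open>Tangency is stated at a single point, so the intersection must be identified
      as the point spanned by p.\<close>
    have meet: "ln i \<inter> trans_line u = vec.span {p}"
    proof (intro subset_antisym subsetI)
      fix v assume v: "v \<in> ln i \<inter> trans_line u"
      obtain x y where xy: "v = P *v x + Q *v y"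
        using decomp_vec by blast
      obtain a b where "x = a *s u" "y = b *s u" "y = A i *v x"
        using v i False unfolding xy Int_iff mem_trans_line mem_graph_iff[OF i False] by blast
      then have "v = a *s p"
        unfolding xy scale_p by (simp add: vec.scale d)
      then show "v \<in> vec.span {p}"
        by (simp add: vec.span_base vec.span_scale)
    next
      fix v assume "v \<in> vec.span {p}"
      then obtain c where v: "v = c *s p"
        unfolding vec.span_singleton by blast
      show "v \<in> ln i \<inter> trans_line u"
        unfolding v scale_p Int_iff mem_trans_line mem_graph_iff[OF i False]
        by (auto simp: vec.scale d vector_smult_assoc)
    qed
    have "quad_form S x = 0 \<and> polar S x v = 0" if "x \<in> vec.span {p}" "v \<in> ln i" for x v
    proof -
      obtain c where c: "x = c *s p"
        using \<open>x \<in> vec.span {p}\<close> unfolding vec.span_singleton by blast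
      obtain z where z: "v = P *v z + Q *v (A i *v z)"
        using ln_graph[OF i False] \<open>v \<in> ln i\<close> by blast
      have "quad_form S p = 0"
        by (simp add: p_def PQform)
      \<comment> \<open>The polar value at p is the very quantity that the Jordan condition makes
        vanish.\<close>
      moreover have "polar S p v = det2 u (A i *v z - d *s z)"
        unfolding p_def z polar_frame[OF PQform] by (simp add: det2_swap[of z u])
      ultimately show ?thesis
        using d(2) by (simp add: c quad_form_scale polar_scale_left)
    qed
    then have "tangent_at (ln i) S (ln i \<inter> trans_line u)"
      unfolding tangent_at_def meet polar_def points_def mem_Collect_eq proj_point_iff
      using \<open>p \<noteq> 0\<close> meet subspace_ln[OF i] vec.subspace_0 by blast
    then show ?thesis ..
  qed (use calculation in simp)
  moreover have "ln l1 \<noteq> ln l2" "ln l1 \<noteq> ln l3" "ln l2 \<noteq> ln l3"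
    using mem distinct inj_on_ln by (simp_all add: inj_on_eq_iff)
  ultimately have *: "ln l1 \<noteq> ln l2 \<and> ln l1 \<noteq> ln l3 \<and> ln l2 \<noteq> ln l3 \<and>
      (\<exists>S. smooth_quadric S \<and> in_quadric (ln l1) S \<and> in_quadric (ln l2) S \<and> in_quadric (ln l3) S \<and>
        (\<forall>L\<in>ln ` I. in_quadric L S \<or> tangent_at L S (L \<inter> trans_line u)))"
    by blast
  show "\<exists>L1\<in>ln ` I. \<exists>L2\<in>ln ` I. \<exists>L3\<in>ln ` I. L1 \<noteq> L2 \<and> L1 \<noteq> L3 \<and> L2 \<noteq> L3 \<and>
      (\<exists>S. smooth_quadric S \<and> in_quadric L1 S \<and> in_quadric L2 S \<and> in_quadric L3 S \<and>
        (\<forall>L\<in>ln ` I. in_quadric L S \<or> tangent_at L S (L \<inter> trans_line u)))"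
    by (rule bexI[of _ "ln l1"], rule bexI[of _ "ln l2"], rule bexI[of _ "ln l3"], rule *)
      (use mem in auto)
qed

lemma transversals_if_commute:
  assumes fin: "finite I" and comm: "\<And>i j. i \<in> I \<Longrightarrow> j \<in> I \<Longrightarrow> A i ** A j = A j ** A i"
  shows "(\<exists>T T'. T \<noteq> T' \<and> transversal (ln ` I) T \<and> transversal (ln ` I) T') \<or>
    (\<exists>T. double_transversal (ln ` I) T)"
proof (rule commuting_matrices_cases[of "A ` I"])
  fix M N assume "M \<in> A ` I" "N \<in> A ` I"
  then show "M ** N = N ** M"
    using comm by blast
next
  fix u v assume uv: "common_eigenvector (A ` I) u" "common_eigenvector (A ` I) v" "det2 u v \<noteq> 0"
  then have "trans_line u \<noteq> trans_line v"
    using trans_line_inj by (auto simp: common_eigenvector_def)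
  with uv show ?thesis
    unfolding transversal_iff by blast
next
  fix u M assume "common_jordan_vector (A ` I) u" "M \<in> A ` I" "\<And>a. M \<noteq> mat a"
  then show ?thesis
    using double_transversal_if_jordan[OF fin] by blast
qed

lemma commute_if_two_transversals:
  assumes "T \<noteq> T'" "transversal (ln ` I) T" "transversal (ln ` I) T'" "i \<in> I" "j \<in> I"
  shows "A i ** A j = A j ** A i"
proof -
  obtain u v where uv: "T = trans_line u" "T' = trans_line v"
      "common_eigenvector (A ` I) u" "common_eigenvector (A ` I) v"
    using assms(2,3) unfolding transversal_iff by blast
  have "det2 u v \<noteq> 0"
  proof
    assume "det2 u v = 0"
    then obtain c where c: "v = c *s u"
      using uv(3) by (auto simp: common_eigenvector_def det2_eq_0_iff)
    with uv(4) have "c \<noteq> 0"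
      by (auto simp: common_eigenvector_def)
    have "trans_line v \<subseteq> trans_line u"
      unfolding trans_line_def c vec.scale
      by (intro vec.span_minimal) (auto intro: vec.span_scale vec.span_base)
    then have "trans_line v = trans_line u"
      using uv(3,4) unfolding trans_line_def
      by (intro subspace_dim2_eq proj_line_span) (auto simp: common_eigenvector_def)
    with assms(1) uv show False by simp
  qed
  with uv assms(4,5) show ?thesis
    using commute_if_two_eigenvectors by blast
qed

end


section \<open>Base change to the algebraic closure\<close>

lemma map_matrix_to_ac_mult: "map_matrix to_ac (M ** N) = map_matrix to_ac M ** map_matrix to_ac N"
  by (simp add: vec_eq_iff matrix_matrix_mult_def to_ac_sum)

lemma map_matrix_to_ac_add: "map_matrix to_ac (M + N) = map_matrix to_ac M + map_matrix to_ac N"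
  by (simp add: vec_eq_iff)

lemma map_matrix_to_ac_diff: "map_matrix to_ac (M - N) = map_matrix to_ac M - map_matrix to_ac N"
  by (simp add: vec_eq_iff)

lemma map_matrix_to_ac_0: "map_matrix to_ac 0 = 0"
  by (simp add: vec_eq_iff)

lemma map_matrix_to_ac_1: "map_matrix to_ac (mat 1) = mat 1"
  by (simp add: vec_eq_iff mat_def)

lemma map_matrix_to_ac_eq_iff: "map_matrix to_ac M = map_matrix to_ac N \<longleftrightarrow> M = N"
  by (simp add: vec_eq_iff)

lemma invertible_map_matrix_to_ac: "invertible M \<Longrightarrow> invertible (map_matrix to_ac M)"
  unfolding invertible_def by (metis map_matrix_to_ac_mult map_matrix_to_ac_1)

text \<open>Both sides are spanned by the columns of M, which are images of the coordinate
  vectors.\<close>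

lemma base_change_range:
  fixes M :: "'a::field ^ 'n ^ 4"
  shows "base_change (range (\<lambda>x. M *v x)) = range (\<lambda>x. map_matrix to_ac M *v x)"
    (is "base_change ?L = ?R")
proof
  have map_vec: "(\<chi> i. to_ac ((M *v x) $ i)) = map_matrix to_ac M *v (\<chi> i. to_ac (x $ i))" for x
    by (simp add: vec_eq_iff matrix_vector_mult_def to_ac_sum)
  then show "base_change ?L \<subseteq> ?R"
    unfolding base_change_def by (intro vec.span_minimal) (auto simp: vec.subspace_image)
  have "column j (map_matrix to_ac M) \<in> base_change ?L" for j
  proof -
    have "column j (map_matrix to_ac M) = (\<chi> i. to_ac ((M *v axis j 1) $ i))"
      by (simp add: column_def vec_eq_iff matrix_vector_mult_def axis_def if_distrib cong: if_cong)
    then show ?thesis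
      unfolding base_change_def by (intro vec.span_base) auto
  qed
  then show "?R \<subseteq> base_change ?L"
    unfolding base_change_def by (auto simp: matrix_mult_sum intro!: vec.span_sum vec.span_scale)
qed

context graph_line_set
begin

text \<open>The same coordinates serve over the closure. The original lines remain the index set, so
  matrices over both fields are compared index by index.\<close>

lemma base_change_graph_lines:
  "graph_lines_closed (map_matrix to_ac P) (map_matrix to_ac Q) (map_matrix to_ac P') (map_matrix to_ac Q')
     LL l1 l2 l3 (\<lambda>i. map_matrix to_ac (A i)) base_change"
proof
  show "base_change l2 = range (\<lambda>x. map_matrix to_ac Q *v x)"
    by (subst ln_l2) (rule base_change_range)
  show "base_change i = range (\<lambda>x. map_matrix to_ac P *v x +
      map_matrix to_ac Q *v (map_matrix to_ac (A i) *v x))" if "i \<in> LL" "i \<noteq> l2" for i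
  proof -
    have "i = range (\<lambda>x. (P + Q ** A i) *v x)"
      using ln_graph[OF that] by (simp add: matrix_vector_mult_add_rdistrib flip: matrix_vector_mul_assoc)
    then have "base_change i = range (\<lambda>x. map_matrix to_ac (P + Q ** A i) *v x)"
      by (metis base_change_range)
    then show ?thesis
      by (simp add: map_matrix_to_ac_add map_matrix_to_ac_mult matrix_vector_mult_add_rdistrib
          flip: matrix_vector_mul_assoc)
  qed
  show "invertible (map_matrix to_ac (A i) - map_matrix to_ac (A j))"
    if "i \<in> LL" "j \<in> LL" "i \<noteq> l2" "j \<noteq> l2" "i \<noteq> j" for i j
    using invertible_map_matrix_to_ac[OF invertible_diff[OF that]] by (simp add: map_matrix_to_ac_diff)
qed (simp_all add: PP PQ QP QQ decomp mem distinct A_l1 A_l2 A_l3 map_matrix_to_ac_0 map_matrix_to_ac_1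
    flip: map_matrix_to_ac_mult map_matrix_to_ac_add)

text \<open>Links the group, studied over K, with the transversals, studied over the closure; it
  holds as \<open>to_ac\<close> is an injective homomorphism.\<close>

lemma commute_iff_base_change:
  "map_matrix to_ac (A i) ** map_matrix to_ac (A j) = map_matrix to_ac (A j) ** map_matrix to_ac (A i)
    \<longleftrightarrow> A i ** A j = A j ** A i"
  by (simp add: map_matrix_to_ac_eq_iff flip: map_matrix_to_ac_mult)

end

theorem theorem2p1p22:
  fixes LL :: "('a::field ^ 4) set set" and L :: "('a ^ 4) set"
  assumes "finite LL" and "card LL \<ge> 3" and "skew_lines LL" and "L \<in> LL"
  shows "comm_group (line_group LL L) \<longleftrightarrow>
           (\<exists>T T'. T \<noteq> T' \<and> transversal (base_change ` LL) T \<and> transversal (base_change ` LL) T') \<or>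
           (\<exists>T. double_transversal (base_change ` LL) T)"
proof -
  obtain l1 l2 l3 where l: "l1 \<in> LL" "l2 \<in> LL" "l3 \<in> LL" "l1 \<noteq> l2" "l1 \<noteq> l3" "l2 \<noteq> l3"
  proof -
    obtain S where "S \<subseteq> LL" "card S = 3"
      using obtain_subset_with_card_n[OF assms(2)] by blast
    moreover from this(2) obtain a b c where "S = {a, b, c}" "a \<noteq> b" "b \<noteq> c" "a \<noteq> c"
      unfolding card_3_iff by blast
    ultimately show thesis
      by (intro that[of a b c]) simp_all
  qed
  obtain P Q P' Q' A where "graph_line_set P Q P' Q' LL l1 l2 l3 A"
    using skew_lines_graph_coordinates[OF assms(3) l] .
  then interpret graph_line_set P Q P' Q' LL l1 l2 l3 A .
  interpret bc: graph_lines_closed "map_matrix to_ac P" "map_matrix to_ac Q" "map_matrix to_ac P'"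
    "map_matrix to_ac Q'" LL l1 l2 l3 "\<lambda>i. map_matrix to_ac (A i)" base_change
    by (rule base_change_graph_lines)
  show ?thesis
  proof (intro iffI; (elim disjE exE conjE)?)
    assume "comm_group (line_group LL L)"
    then show "(\<exists>T T'. T \<noteq> T' \<and> transversal (base_change ` LL) T \<and> transversal (base_change ` LL) T') \<or>
        (\<exists>T. double_transversal (base_change ` LL) T)"
      using commute_if_comm_line_group[OF _ assms(4)]
      by (intro bc.transversals_if_commute assms(1)) (simp add: commute_iff_base_change)
  next
    fix T T' assume T: "T \<noteq> T'" "transversal (base_change ` LL) T" "transversal (base_change ` LL) T'"
    show "comm_group (line_group LL L)"
      using bc.commute_if_two_transversals[OF T] comm_line_group_if_commute[OF assms(4)]
      unfolding commute_iff_base_change by blast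
  next
    fix T assume T: "double_transversal (base_change ` LL) T"
    then obtain m1 m2 m3 S where m: "m1 \<in> LL" "m2 \<in> LL" "m3 \<in> LL"
        "base_change m1 \<noteq> base_change m2" "base_change m1 \<noteq> base_change m3" "base_change m2 \<noteq> base_change m3"
      and S: "smooth_quadric S" "in_quadric (base_change m1) S" "in_quadric (base_change m2) S"
        "in_quadric (base_change m3) S"
        "\<And>M. M \<in> LL \<Longrightarrow> in_quadric (base_change M) S \<or> tangent_at (base_change M) S (base_change M \<inter> T)"
      and trans: "transversal (base_change ` LL) T"
      unfolding double_transversal_def by blast
    then have ne: "m1 \<noteq> m2" "m1 \<noteq> m3" "m2 \<noteq> m3" by blast+
    text \<open>The quadric is tied to the lines \<open>m1\<close>, \<open>m2\<close>, \<open>m3\<close>, so the coordinates have to be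
      adapted to these.\<close>
    obtain R U R' U' B where "graph_line_set R U R' U' LL m1 m2 m3 B"
      using skew_lines_graph_coordinates[OF assms(3) m(1-3) ne] .
    then interpret m: graph_line_set R U R' U' LL m1 m2 m3 B .
    interpret mbc: graph_lines_closed "map_matrix to_ac R" "map_matrix to_ac U" "map_matrix to_ac R'"
      "map_matrix to_ac U'" LL m1 m2 m3 "\<lambda>i. map_matrix to_ac (B i)" base_change
      by (rule m.base_change_graph_lines)
    \<comment> \<open>The group does not depend on the coordinates, so commutation of the new
      matrices suffices.\<close>
    show "comm_group (line_group LL L)"
      using mbc.commute_if_tangent[OF trans S] m.comm_line_group_if_commute[OF assms(4)]
      unfolding m.commute_iff_base_change by blast
  qed
qed

end
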